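(* Let $b,c\ge2$ be integers with $b\mid c$, let $l\ge0$, $n\ge2$ and $r\ge0$ be integers, and let $z$ be an indeterminate. Then $$\frac{1}{(1-q^b)^2}\Big(T_{bc,l}^{(b)}(bn,br;q,z)-(-1)^{(b-1)nr}\,T_{c,l}^{(b)}\big(n,r;q^b,z^bq^{n\binom{b}{2}}\big)\Big)$$ $$\equiv-\frac{\lfloor (n-2)b/c\rfloor!}{\lfloor nb/c\rfloor!}\cdot\frac{(b^2-1)n^2(n-1)}{24}\cdot z^b\,T_{c,l}^{(b)}(n-2,r-1;q^b,z^b)\pmod{\Phi_b(q)}.$$ In particular, $$T_{b^2,l}^{(b)}(bn,br;q,z)-(-1)^{(b-1)nr}\,T_{b,l}^{(b)}\big(n,r;q^b,z^bq^{n\binom{b}{2}}\big)\equiv-\frac{(b^2-1)n}{24}\cdot z^b(1-q^b)^2\,T_{b,l}^{(b)}(n-2,r-1;q^b,z^b)\pmod{\Phi_b(q)^3}.$$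
   Context: $[m]_q=\frac{1-q^m}{1-q}$, $[m]_q!=[m]_q\cdots[1]_q$ ($[0]_q!=1$); $m!$ without subscript is the ordinary factorial. For integers $m$ and $k>0$, $\begin{bmatrix} m\\ k\end{bmatrix}_q=\frac{[m]_q\cdots[m-k+1]_q}{[k]_q\cdots[1]_q}$, $\begin{bmatrix} m\\ 0\end{bmatrix}_q=1$, $\begin{bmatrix} m\\ k\end{bmatrix}_q=0$ for $k<0$. $\Phi_d$ is the $d$-th cyclotomic polynomial. For positive integers $b\mid c$, integers $l,n\ge0$ and $r$, define $$T_{c,l}^{(b)}(n,r;q,z)=\frac{[l]_{q^{c}}!\,\Phi_c(q)^l}{[\lfloor nb/c\rfloor]_{q^{c/b}}!}\sum_{\substack{k\in\mathbb{Z}\\k\equiv r\pmod{c}}}(-1)^kz^kq^{\binom{k}{2}}\begin{bmatrix} n\\ k\end{bmatrix}_{q}\begin{bmatrix} (k-r)/c\\ l\end{bmatrix}_{q^{c}};$$ an expression such as $T_{c,l}^{(b)}(n,r;q^b,w)$ denotes this with $q$ replaced by $q^b$ everywhere (including in $\Phi_c$) and $z$ replaced by $w$. For rational functions $A,B$ in $q$ with coefficients in $\mathbb{Q}[z]$ and $m\ge1$, $A\equiv B\pmod{\Phi_b(q)^m}$ means $A-B=\Phi_b(q)^m\,U/V$ with $U\in\mathbb{Q}[z][q,q^{-1}]$ and $V\in\mathbb{Q}[q]$ a nonzero polynomial not divisible by $\Phi_b(q)$. *)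

theory Defs
  imports
    "HOL-Computational_Algebra.Computational_Algebra"
    "HOL-Library.Groups_Big_Fun"
    "HOL-Number_Theory.Cong"
    Complex_Main
begin

definition primitive_roots :: "nat \<Rightarrow> complex set" where
  "primitive_roots n = {w. n > 0 \<and> w ^ n = 1 \<and> (\<forall>k. 0 < k \<and> k < n \<longrightarrow> w ^ k \<noteq> 1)}"

text \<open>The cyclotomic polynomial lives over the integers so that it can be evaluated in any field;
  lemma \<open>cyclotomic_eq_prod\<close> below shows that the description is satisfiable.\<close>

definition cyclotomic :: "nat \<Rightarrow> int poly" where
  "cyclotomic n = (THE p. map_poly of_int p = (\<Prod>w\<in>primitive_roots n. [:- w, 1:]))"

lemma finite_primitive_roots: "finite (primitive_roots n)"
proof (cases "n = 0")
  case False
  have "primitive_roots n \<subseteq> {w. w ^ n = 1}"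
    by (auto simp: primitive_roots_def)
  then show ?thesis
    using finite_roots_unity[of n, where ?'a = complex] False finite_subset by (metis One_nat_def Suc_leI neq0_conv)
qed (simp add: primitive_roots_def)

lemma roots_of_unity_partition:
  assumes "n > 0"
  shows "{w::complex. w ^ n = 1} = (\<Union>d\<in>{d. d dvd n}. primitive_roots d)"
proof (intro equalityI subsetI)
  fix w :: complex assume "w \<in> {w. w ^ n = 1}"
  then have w: "w ^ n = 1" by simp
  define d where "d = (LEAST k. k > 0 \<and> w ^ k = 1)"
  have d: "d > 0" "w ^ d = 1"
    using LeastI[of "\<lambda>k. k > 0 \<and> w ^ k = 1" n] w assms unfolding d_def by auto
  have least: "w ^ k \<noteq> 1" if "0 < k" "k < d" for k
    using not_less_Least[of k "\<lambda>k. k > 0 \<and> w ^ k = 1"] that unfolding d_def by auto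
  have "w ^ n = (w ^ d) ^ (n div d) * w ^ (n mod d)"
    by (metis mult_div_mod_eq power_add power_mult)
  then have "w ^ (n mod d) = 1" using w d by simp
  then have "n mod d = 0" using least[of "n mod d"] d(1) by (cases "n mod d = 0") auto
  then show "w \<in> (\<Union>d\<in>{d. d dvd n}. primitive_roots d)"
    using d least by (auto simp: primitive_roots_def)
qed (auto simp: primitive_roots_def dvd_def power_mult)

lemma primitive_roots_disjoint:
  assumes "c \<noteq> d"
  shows "primitive_roots c \<inter> primitive_roots d = {}"
  using assms by (auto simp: primitive_roots_def) (metis linorder_neqE_nat)

lemma prod_roots_of_unity:
  assumes "n > 0"
  shows "(\<Prod>w\<in>{w::complex. w ^ n = 1}. [:- w, 1:]) = monom 1 n - 1"
proof -
  let ?R = "{w::complex. w ^ n = 1}"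
  let ?P = "\<Prod>w\<in>?R. [:- w, 1:]"
  have fin: "finite ?R" using finite_roots_unity[of n, where ?'a = complex] assms by simp
  have card: "card ?R = n" using card_roots_unity_eq[of n] assms by simp
  have degP: "degree ?P = n"
    by (subst degree_prod_eq_sum_degree) (auto simp: card)
  have lcP: "lead_coeff ?P = 1"
    by (simp add: lead_coeff_prod)
  have degQ: "degree (monom 1 n - 1 :: complex poly) = n"
    using assms degree_add_eq_left[of "- 1 :: complex poly" "monom 1 n"]
    by (simp add: degree_monom_eq)
  have lcQ: "coeff (monom 1 n - 1 :: complex poly) n = 1"
    using assms by simp
  let ?D = "?P - (monom 1 n - 1)"
  have "?D = 0"
  proof (rule ccontr)
    assume D: "?D \<noteq> 0"
    have "degree ?D \<le> n" using degP degQ by (metis degree_diff_le order_refl)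
    moreover have "coeff ?D n = 0" using lcP lcQ degP by simp
    ultimately have "degree ?D < n"
      using D by (metis le_neq_implies_less leading_coeff_0_iff)
    moreover have "?R \<subseteq> {x. poly ?D x = 0}"
    proof
      fix x assume "x \<in> ?R"
      then have "poly ?P x = 0" using fin by (auto simp: poly_prod)
      then show "x \<in> {x. poly ?D x = 0}" using \<open>x \<in> ?R\<close> by (simp add: poly_monom)
    qed
    then have "n \<le> card {x. poly ?D x = 0}"
      using card_mono[OF poly_roots_finite[OF D]] card by metis
    moreover have "card {x. poly ?D x = 0} \<le> degree ?D"
      using D by (rule card_poly_roots_bound)
    ultimately show False by simp
  qed
  then show ?thesis by simp
qed

lemma int_poly_quotient:
  fixes f g :: "int poly" and Q :: "complex poly"
  assumes "lead_coeff g = 1" and eq: "map_poly of_int f = Q * map_poly of_int g"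
  shows "\<exists>p. map_poly of_int p = Q"
proof -
  let ?c = "map_poly of_int :: int poly \<Rightarrow> complex poly"
  have g: "g \<noteq> 0" using assms(1) by auto
  obtain p r where pr: "pseudo_divmod f g = (p, r)" by fastforce
  have f: "f = g * p + r" and r: "r = 0 \<or> degree r < degree g"
    using pseudo_divmod[OF g pr] assms(1) by auto
  have hom: "?c (a * b) = ?c a * ?c b" "?c (a + b) = ?c a + ?c b" for a b
    by (auto simp: poly_eq_iff coeff_map_poly coeff_mult)
  have deg: "degree (?c a) = degree a" for a
    by (rule degree_map_poly) auto
  have gc: "?c g \<noteq> 0" using g by (simp add: map_poly_eq_0_iff)
  have rc: "?c r = (Q - ?c p) * ?c g"
    using eq unfolding f hom by (simp add: algebra_simps)
  have "Q - ?c p = 0"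
  proof (rule ccontr)
    assume "Q - ?c p \<noteq> 0"
    then have "degree (?c r) = degree (Q - ?c p) + degree g" and "?c r \<noteq> 0"
      unfolding rc using gc by (simp_all add: degree_mult_eq deg)
    then show False using r by (auto simp: deg)
  qed
  then show ?thesis by auto
qed

lemma int_poly_prod_primitive_roots:
  "\<exists>p :: int poly. map_poly of_int p = (\<Prod>w\<in>primitive_roots n. [:- w, 1:]) \<and> lead_coeff p = 1"
proof (induction n rule: less_induct)
  case (less n)
  show ?case
  proof (cases "n = 0")
    case True
    then show ?thesis
      by (intro exI[of _ 1]) (simp add: primitive_roots_def)
  next
    case False
    let ?c = "map_poly of_int :: int poly \<Rightarrow> complex poly"
    let ?P = "\<lambda>d. \<Prod>w\<in>primitive_roots d. [:- w, 1:]"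
    let ?D = "{d. d dvd n} - {n}"
    have hom: "?c (a * b) = ?c a * ?c b" for a b
      by (auto simp: poly_eq_iff coeff_map_poly coeff_mult)
    have prod_hom: "?c (prod h A) = (\<Prod>a\<in>A. ?c (h a))" for h :: "nat \<Rightarrow> int poly" and A
      by (induction A rule: infinite_finite_induct) (simp_all add: hom)
    have finD: "finite {d. d dvd n}" using False by simp
    have "d < n" if "d \<in> ?D" for d
      using that False by (auto dest!: dvd_imp_le simp: le_less)
    then have "\<forall>d\<in>?D. \<exists>p. ?c p = ?P d \<and> lead_coeff p = 1"
      using less.IH by blast
    then obtain h where h: "\<And>d. d \<in> ?D \<Longrightarrow> ?c (h d) = ?P d \<and> lead_coeff (h d) = 1"
      by metis
    have "?c (monom 1 n - 1) = monom 1 n - 1"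
      by (auto simp: poly_eq_iff coeff_map_poly)
    also have "\<dots> = (\<Prod>w\<in>(\<Union>d\<in>{d. d dvd n}. primitive_roots d). [:- w, 1:])"
      using prod_roots_of_unity[of n] roots_of_unity_partition[of n] False by simp
    also have "\<dots> = (\<Prod>d\<in>{d. d dvd n}. ?P d)"
      using finD finite_primitive_roots primitive_roots_disjoint
      by (intro prod.UNION_disjoint) auto
    also have "\<dots> = ?P n * (\<Prod>d\<in>?D. ?P d)"
      using finD by (subst prod.remove[of _ n]) auto
    also have "(\<Prod>d\<in>?D. ?P d) = ?c (\<Prod>d\<in>?D. h d)"
      unfolding prod_hom using h by (intro prod.cong) auto
    finally have eq: "?c (monom 1 n - 1) = ?P n * ?c (\<Prod>d\<in>?D. h d)" .
    have "lead_coeff (\<Prod>d\<in>?D. h d) = 1"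
      using h by (simp add: lead_coeff_prod)
    from int_poly_quotient[OF this eq] obtain p where p: "?c p = ?P n" by auto
    have "degree (?c p) = degree p" by (rule degree_map_poly) auto
    then have "of_int (lead_coeff p) = lead_coeff (?P n)"
      using p by (metis coeff_map_poly of_int_0)
    then have "lead_coeff p = 1" by (simp add: lead_coeff_prod)
    then show ?thesis using p by auto
  qed
qed

lemma cyclotomic_eq_prod:
  "map_poly of_int (cyclotomic n) = (\<Prod>w\<in>primitive_roots n. [:- w, 1:])"
proof -
  have "\<exists>!p :: int poly. map_poly of_int p = (\<Prod>w\<in>primitive_roots n. [:- w, 1:])"
  proof (rule ex_ex1I)
    fix p p' :: "int poly"
    assume "map_poly of_int p = (\<Prod>w\<in>primitive_roots n. [:- w, 1:])"
      and "map_poly of_int p' = (\<Prod>w\<in>primitive_roots n. [:- w, 1:])"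
    then have "map_poly of_int p = (map_poly of_int p' :: complex poly)" by simp
    then show "p = p'" by (auto simp: poly_eq_iff coeff_map_poly)
  qed (use int_poly_prod_primitive_roots in blast)
  from theI'[OF this] show ?thesis unfolding cyclotomic_def .
qed

definition cyclotomic_at :: "nat \<Rightarrow> 'a::field \<Rightarrow> 'a" where
  "cyclotomic_at d x = poly (map_poly of_int (cyclotomic d)) x"

definition qint :: "'a::field \<Rightarrow> int \<Rightarrow> 'a" where
  "qint q m = (1 - q powi m) / (1 - q)"

definition qfact :: "'a::field \<Rightarrow> nat \<Rightarrow> 'a" where
  "qfact q m = (\<Prod>i=1..m. qint q (int i))"

definition qbinom :: "'a::field \<Rightarrow> int \<Rightarrow> int \<Rightarrow> 'a" where
  "qbinom q m k = (if k < 0 then 0 else (\<Prod>i<nat k. qint q (m - int i)) / qfact q (nat k))"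

text \<open>The variable \<open>q\<close> is a parameter ranging over a field, so replacing \<open>q\<close> by \<open>q\<^sup>b\<close> and \<open>z\<close> by \<open>w\<close>
  is application to other arguments. \<^const>\<open>Sum_any\<close> sums over the integers \<open>k\<close> with nonzero
  summand; these satisfy \<open>0 \<le> k \<le> n\<close>, since otherwise \<^term>\<open>qbinom q (int n) k\<close> vanishes.\<close>

definition qT :: "nat \<Rightarrow> nat \<Rightarrow> nat \<Rightarrow> nat \<Rightarrow> int \<Rightarrow> 'a::field \<Rightarrow> 'a \<Rightarrow> 'a" where
  "qT b c l n r q z =
     qfact (q ^ c) l * cyclotomic_at c q ^ l / qfact (q ^ (c div b)) (n * b div c) *
     Sum_any (\<lambda>k::int. if [k = r] (mod int c)
       then (- 1) powi k * z powi k * q powi (k * (k - 1) div 2) *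
            qbinom q (int n) k * qbinom (q ^ c) ((k - r) div int c) (int l)
       else 0)"

text \<open>The inner polynomial variable is \<open>z\<close>, the outer one is \<open>q\<close>.\<close>

type_synonym ratfun = "rat poly poly fract"

definition qvar :: ratfun where
  "qvar = to_fract [:0, 1:]"

definition zvar :: ratfun where
  "zvar = to_fract [:[:0, 1:]:]"

definition laurent_polys :: "ratfun set" where
  "laurent_polys = {to_fract P * qvar powi j | P j. True}"

definition of_qpoly :: "rat poly \<Rightarrow> ratfun" where
  "of_qpoly V = to_fract (map_poly (\<lambda>a. [:a:]) V)"

definition cong_cyclotomic :: "nat \<Rightarrow> nat \<Rightarrow> ratfun \<Rightarrow> ratfun \<Rightarrow> bool" where
  "cong_cyclotomic b m A B \<longleftrightarrow>
     (\<exists>U\<in>laurent_polys. \<exists>V::rat poly. V \<noteq> 0 \<and> \<not> map_poly of_int (cyclotomic b) dvd V \<and>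
        A - B = cyclotomic_at b qvar ^ m * U / of_qpoly V)"

end

theory Submission
  imports Defs
begin

text \<open>At a primitive \<open>b\<close>-th root of unity \<open>\<zeta>\<close>, substitute \<open>q = \<zeta> exp X\<close>. A polynomial over the
  rationals is divisible by \<open>\<Phi>\<^sub>b(q)\<^sup>m\<close> iff the resulting power series vanishes to order \<open>m\<close> for every
  \<open>\<zeta>\<close>, so the congruences become statements about a few coefficients of power series.

  The prefactors of the two \<open>T\<close>'s on the left agree because \<open>\<Phi>\<^sub>c(q\<^sup>b) = \<Phi>\<^sub>b\<^sub>c(q)\<close> for \<open>b\<close> dividing \<open>c\<close>,
  and the sums are compared term by term. With \<open>n = m + j\<close>, the \<open>q\<close>-binomial of \<open>(bn, bj)\<close> is that of
  \<open>(n, j)\<close> at \<open>q\<^sup>b\<close> times the product of \<open>(1 - q\<^bsup>b(m+s)+u\<^esup>) / (1 - q\<^bsup>bs+u\<^esup>)\<close> over \<open>s < j\<close> and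
  \<open>0 < u < b\<close>. The first two coefficients of its logarithm in \<open>X\<close> reduce to sums over \<open>u\<close> of
  \<open>\<zeta>\<^sup>u / (1 - \<zeta>\<^sup>u)\<close> and \<open>\<zeta>\<^sup>u / (1 - \<zeta>\<^sup>u)\<^sup>2\<close>, which are read off from the identity
  \<open>\<Prod>\<^sub>u (1 - \<zeta>\<^sup>u exp X) = 1 + exp X + \<dots> + exp ((b - 1) X)\<close>; the quadratic coefficient
  \<open>(b\<^sup>2 - 1) / 24\<close> of its logarithm is the one in the theorem.\<close>

subsection \<open>Coefficientwise homomorphisms of polynomials\<close>

text \<open>Four embeddings share these facts: integers into a ring, rationals into a field of
  characteristic 0, scalars into polynomials, and scalars into power series.\<close>

locale coeff_hom =
  fixes h :: "'a::comm_ring_1 \<Rightarrow> 'b::comm_ring_1"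
  assumes hom_add: "h (x + y) = h x + h y"
    and hom_mult: "h (x * y) = h x * h y"
    and hom_1: "h 1 = 1"
begin

lemma hom_0 [simp]: "h 0 = 0"
  using hom_add[of 0 0] by simp

lemma hom_sum: "h (sum f A) = (\<Sum>i\<in>A. h (f i))"
  by (induction A rule: infinite_finite_induct) (simp_all add: hom_add)

lemma map_poly_hom_pCons [simp]: "map_poly h (pCons a p) = pCons (h a) (map_poly h p)"
  by (auto simp: poly_eq_iff coeff_map_poly coeff_pCons split: nat.splits)

lemma map_poly_hom_add: "map_poly h (p + q) = map_poly h p + map_poly h q"
  by (simp add: poly_eq_iff coeff_map_poly hom_add)

lemma map_poly_hom_mult: "map_poly h (p * q) = map_poly h p * map_poly h q"
  by (simp add: poly_eq_iff coeff_map_poly coeff_mult hom_mult hom_sum)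

lemma map_poly_hom_1 [simp]: "map_poly h 1 = 1"
  by (simp add: one_pCons hom_1)

lemma map_poly_hom_uminus: "map_poly h (- p) = - map_poly h p"
  using map_poly_hom_add[of p "- p"] by (simp add: eq_neg_iff_add_eq_0 add.commute)

lemma map_poly_hom_diff: "map_poly h (p - q) = map_poly h p - map_poly h q"
  using map_poly_hom_add[of p "- q"] by (simp add: map_poly_hom_uminus)

lemma map_poly_hom_power: "map_poly h (p ^ n) = map_poly h p ^ n"
  by (induction n) (simp_all add: map_poly_hom_mult)

lemmas map_poly_hom = map_poly_hom_add map_poly_hom_mult map_poly_hom_uminus map_poly_hom_diff
  map_poly_hom_power

end

interpretation int_hom: coeff_hom "of_int :: int \<Rightarrow> 'a::comm_ring_1"
  by standard simp_all

interpretation rat_hom: coeff_hom "of_rat :: rat \<Rightarrow> 'a::field_char_0"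
  by standard (simp_all add: of_rat_add of_rat_mult)

interpretation const_hom: coeff_hom "\<lambda>a::'a::comm_ring_1. [:a:]"
  by standard (simp_all add: one_pCons)

interpretation fps_const_hom: coeff_hom "fps_const :: 'a::comm_ring_1 \<Rightarrow> 'a fps"
  by standard simp_all

subsection \<open>Cyclotomic polynomials\<close>

lemma primitive_root_power_eq_1_iff:
  assumes "w \<in> primitive_roots n"
  shows "w ^ k = 1 \<longleftrightarrow> n dvd k"
proof
  assume "w ^ k = 1"
  have n: "n > 0" "w ^ n = 1" "\<And>j. 0 < j \<Longrightarrow> j < n \<Longrightarrow> w ^ j \<noteq> 1"
    using assms by (auto simp: primitive_roots_def)
  have "w ^ k = (w ^ n) ^ (k div n) * w ^ (k mod n)"
    by (metis mult_div_mod_eq power_add power_mult)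
  then have "w ^ (k mod n) = 1" using n \<open>w ^ k = 1\<close> by simp
  then show "n dvd k"
    using n(3)[of "k mod n"] n(1) by (metis mod_less_divisor neq0_conv mod_eq_0_iff_dvd)
next
  assume "n dvd k"
  then show "w ^ k = 1"
    using assms by (auto simp: primitive_roots_def power_mult elim!: dvdE)
qed

lemma primitive_rootsI:
  assumes "n > 0" "\<And>k. w ^ k = 1 \<longleftrightarrow> n dvd k"
  shows "w \<in> primitive_roots n"
  using assms by (auto simp: primitive_roots_def dest: dvd_imp_le)

text \<open>The witness is \<open>cis (2 * pi / real n)\<close>. Nonemptiness keeps the condition
  \<open>unit_at\<close> below from being vacuous, so that it excludes 0 and all multiples of the
  cyclotomic polynomial as denominators.\<close>

lemma primitive_roots_nonempty:
  assumes "n > 0"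
  shows "primitive_roots n \<noteq> {}"
proof -
  define w where "w = cis (2 * pi / real n)"
  have bij: "bij_betw (\<lambda>k. cis (2 * pi * real k / real n)) {..<n} {z. z ^ n = 1}"
    using assms by (rule bij_betw_roots_unity)
  have w: "w ^ k = cis (2 * pi * real k / real n)" for k
    by (simp add: w_def DeMoivre mult_ac)
  have "w ^ n = 1" using assms by (simp add: w)
  moreover have "w ^ k \<noteq> 1" if "0 < k" "k < n" for k
    using inj_onD[OF bij_betw_imp_inj_on[OF bij], of k 0] that assms by (auto simp: w)
  ultimately show ?thesis using assms by (auto simp: primitive_roots_def)
qed

text \<open>If \<open>w ^ b\<close> has order \<open>c\<close>, then \<open>w ^ k = 1\<close> forces
  \<open>c dvd k\<close>, hence \<open>b dvd k\<close> because \<open>b dvd c\<close>. Writing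
  \<open>k = b * t\<close> turns \<open>w ^ k = 1\<close> into \<open>c dvd t\<close>.\<close>

lemma power_in_primitive_roots_iff:
  assumes "b dvd c" "b > 0" "c > 0"
  shows "w ^ b \<in> primitive_roots c \<longleftrightarrow> w \<in> primitive_roots (b * c)"
proof
  assume w: "w ^ b \<in> primitive_roots c"
  have iff: "w ^ (b * k) = 1 \<longleftrightarrow> c dvd k" for k
    using primitive_root_power_eq_1_iff[OF w, of k] by (simp add: power_mult)
  show "w \<in> primitive_roots (b * c)"
  proof (rule primitive_rootsI)
    fix k
    show "w ^ k = 1 \<longleftrightarrow> b * c dvd k"
    proof
      assume k: "w ^ k = 1"
      then have "w ^ (b * k) = 1" by (metis mult.commute power_mult power_one)
      then have "b dvd k" using iff assms(1) dvd_trans by blast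
      then obtain t where "k = b * t" by (elim dvdE)
      then show "b * c dvd k" using k iff by simp
    qed (use iff in \<open>auto elim!: dvdE simp: mult.assoc\<close>)
  qed (use assms in simp)
next
  assume "w \<in> primitive_roots (b * c)"
  from primitive_root_power_eq_1_iff[OF this] show "w ^ b \<in> primitive_roots c"
    using assms by (intro primitive_rootsI) (simp_all flip: power_mult)
qed

text \<open>Multiplication by one fixed root \<open>v0\<close> carries the \<open>b\<close>-th roots
  of unity to the \<open>b\<close>-th roots of \<open>w\<close>, so the factorization of
  \<open>x ^ b - 1\<close> can be rescaled.\<close>

lemma prod_nth_roots:
  fixes x w :: complex
  assumes "b > 0" "w \<noteq> 0"
  shows "(\<Prod>v\<in>{v. v ^ b = w}. x - v) = x ^ b - w"
proof -
  obtain v0 where v0: "v0 ^ b = w"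
    using card_nth_roots[OF assms(2,1)] assms(1)
    by (metis (mono_tags, lifting) Collect_empty_eq card.empty less_numeral_extra(3))
  then have nz: "v0 \<noteq> 0" using assms by (auto simp: power_0_left)
  let ?R = "{u::complex. u ^ b = 1}"
  have bij: "bij_betw (\<lambda>u. v0 * u) ?R {v. v ^ b = w}"
    by (rule bij_betwI[where g = "\<lambda>v. v / v0"])
       (use v0 nz in \<open>auto simp: power_mult_distrib power_divide\<close>)
  have card: "card ?R = b" using card_roots_unity_eq[of b] assms by simp
  have "(\<Prod>v\<in>{v. v ^ b = w}. x - v) = (\<Prod>u\<in>?R. x - v0 * u)"
    using prod.reindex_bij_betw[OF bij, of "\<lambda>v. x - v"] by simp
  also have "\<dots> = (\<Prod>u\<in>?R. v0 * poly [:- u, 1:] (x / v0))"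
    using nz by (intro prod.cong) (auto simp: field_simps)
  also have "\<dots> = w * poly (\<Prod>u\<in>?R. [:- u, 1:]) (x / v0)"
    by (simp add: prod.distrib poly_prod card v0)
  also have "\<dots> = x ^ b - w"
    using assms nz v0
    by (simp add: prod_roots_of_unity poly_monom power_divide right_diff_distrib)
  finally show ?thesis .
qed

text \<open>The primitive roots of order \<open>b * c\<close> split into the fibres of the
  \<open>b\<close>-th power map over the primitive \<open>c\<close>-th roots, and the fibre over
  \<open>w\<close> contributes \<open>x ^ b - w\<close>.\<close>

lemma cyclotomic_mult_dvd:
  assumes "b dvd c" "b > 0" "c > 0"
  shows "cyclotomic (b * c) = pcompose (cyclotomic c) (monom 1 b)"
proof -
  let ?c = "map_poly of_int :: int poly \<Rightarrow> complex poly"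
  have nz: "w \<noteq> 0" if "w \<in> primitive_roots c" for w
    using that by (auto simp: primitive_roots_def power_0_left)
  have fin: "finite {v::complex. v ^ b = w}" if "w \<in> primitive_roots c" for w
    using card_nth_roots[OF nz[OF that] assms(2)] assms(2) card.infinite by fastforce
  have pc: "?c (pcompose p (monom 1 b)) = pcompose (?c p) (monom 1 b)" for p
    by (induction p) (simp_all add: pcompose_pCons int_hom.map_poly_hom map_poly_monom)
  have "?c (cyclotomic (b * c)) = ?c (pcompose (cyclotomic c) (monom 1 b))"
  proof (rule poly_ext)
    fix x :: complex
    have "poly (?c (pcompose (cyclotomic c) (monom 1 b))) x = (\<Prod>w\<in>primitive_roots c. x ^ b - w)"
      by (simp add: pc poly_pcompose poly_monom cyclotomic_eq_prod poly_prod)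
    also have "\<dots> = (\<Prod>w\<in>primitive_roots c. \<Prod>v\<in>{v. v ^ b = w}. x - v)"
      using prod_nth_roots[OF assms(2)] nz by (intro prod.cong) auto
    also have "\<dots> = (\<Prod>v\<in>(\<Union>w\<in>primitive_roots c. {v. v ^ b = w}). x - v)"
      using finite_primitive_roots fin by (intro prod.UNION_disjoint[symmetric]) auto
    also have "(\<Union>w\<in>primitive_roots c. {v. v ^ b = w}) = primitive_roots (b * c)"
      using power_in_primitive_roots_iff[OF assms] by auto
    also have "(\<Prod>v\<in>primitive_roots (b * c). x - v) = poly (?c (cyclotomic (b * c))) x"
      by (simp add: cyclotomic_eq_prod poly_prod)
    finally show "poly (?c (cyclotomic (b * c))) x = poly (?c (pcompose (cyclotomic c) (monom 1 b))) x" ..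
  qed
  then show ?thesis by (auto simp: poly_eq_iff coeff_map_poly)
qed

lemma cyclotomic_at_mult_dvd:
  fixes x :: "'a::field"
  assumes "b dvd c" "b > 0" "c > 0"
  shows "cyclotomic_at (b * c) x = cyclotomic_at c (x ^ b)"
proof -
  have "poly (map_poly of_int (pcompose p (monom 1 b))) x = poly (map_poly of_int p) (x ^ b)" for p
    by (induction p) (simp_all add: pcompose_pCons int_hom.map_poly_hom map_poly_monom poly_monom)
  then show ?thesis
    by (simp add: cyclotomic_at_def cyclotomic_mult_dvd[OF assms])
qed

subsection \<open>Expansion at roots of unity\<close>

text \<open>The product over \<open>S\<close> does not vanish at the new point \<open>a\<close>, so
  after dividing by it the cofactor still has the full order of \<open>p\<close> at
  \<open>a\<close>.\<close>

lemma prod_linear_power_dvd: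
  fixes p :: "'a::field poly"
  assumes "finite S" "\<And>a. a \<in> S \<Longrightarrow> [:- a, 1:] ^ m dvd p"
  shows "(\<Prod>a\<in>S. [:- a, 1:]) ^ m dvd p"
  using assms
proof (induction S rule: finite_induct)
  case (insert a S)
  let ?W = "\<Prod>a\<in>S. [:- a, 1:]"
  show ?case
  proof (cases "p = 0")
    case False
    obtain t where t: "p = ?W ^ m * t" using insert by (auto elim!: dvdE)
    have "poly ?W a \<noteq> 0" using insert.hyps by (auto simp: poly_prod)
    then have "order a (?W ^ m) = 0" by (simp add: order_0I)
    then have "order a p = order a t" using False unfolding t by (simp add: order_mult)
    moreover have "m \<le> order a p" using insert.prems[of a] False by (simp add: order_divides)
    ultimately have "[:- a, 1:] ^ m dvd t" by (simp add: order_divides)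
    then show ?thesis using insert.hyps
      by (simp add: t power_mult_distrib mult.commute[of "?W ^ m"] mult_dvd_mono del: mult_pCons_left)
  qed simp
qed simp

text \<open>With \<zeta> exp X in place of \<zeta> + X, a power \<open>q ^ k\<close> becomes
  \<open>\<zeta> ^ k\<close> times exp (k X), so that exponents of \<open>q\<close> enter logarithms
  linearly.\<close>

definition expand_poly :: "complex \<Rightarrow> complex poly \<Rightarrow> complex fps" where
  "expand_poly \<zeta> p = poly (map_poly fps_const p) (fps_const \<zeta> * fps_exp 1)"

abbreviation expand_rat :: "complex \<Rightarrow> rat poly \<Rightarrow> complex fps" where
  "expand_rat \<zeta> P \<equiv> expand_poly \<zeta> (map_poly of_rat P)"

lemma expand_poly_simps [simp]:
  "expand_poly \<zeta> 0 = 0" "expand_poly \<zeta> 1 = 1"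
  "expand_poly \<zeta> (p + q) = expand_poly \<zeta> p + expand_poly \<zeta> q"
  "expand_poly \<zeta> (p * q) = expand_poly \<zeta> p * expand_poly \<zeta> q"
  "expand_poly \<zeta> (- p) = - expand_poly \<zeta> p"
  "expand_poly \<zeta> (p ^ n) = expand_poly \<zeta> p ^ n"
  "expand_poly \<zeta> (pCons a p) = fps_const a + fps_const \<zeta> * fps_exp 1 * expand_poly \<zeta> p"
  by (simp_all add: expand_poly_def fps_const_hom.map_poly_hom)

lemma expand_poly_nth_0 [simp]: "expand_poly \<zeta> p $ 0 = poly p \<zeta>"
  by (induction p) simp_all

text \<open>The factor \<open>[:- \<zeta>, 1:]\<close> expands to \<zeta> (exp X - 1), of subdegree
  1 because \<zeta> is nonzero, while a cofactor not vanishing at \<zeta> has nonzero constant term.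
  Hence the subdegree of the expansion is the order of \<open>p\<close> at \<zeta>.\<close>

lemma linear_power_dvd_of_expand:
  assumes "\<zeta> \<noteq> 0" "\<And>i. i < m \<Longrightarrow> expand_poly \<zeta> p $ i = 0"
  shows "[:- \<zeta>, 1:] ^ m dvd p"
proof (cases "p = 0")
  case False
  let ?E = "expand_poly \<zeta>" and ?k = "order \<zeta> p"
  obtain s where p: "p = [:- \<zeta>, 1:] ^ ?k * s" and s: "\<not> [:- \<zeta>, 1:] dvd s"
    using order_decomp[OF False] by blast
  have lin: "subdegree (?E [:- \<zeta>, 1:]) = 1"
    using assms(1) by (intro subdegreeI) auto
  then have lin0: "?E [:- \<zeta>, 1:] \<noteq> 0" by fastforce
  have s0: "?E s $ 0 \<noteq> 0" using s by (simp add: poly_eq_0_iff_dvd)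
  then have sE: "?E s \<noteq> 0" by (metis fps_zero_nth)
  have E: "?E p = ?E [:- \<zeta>, 1:] ^ ?k * ?E s" using p expand_poly_simps(4,6) by metis
  have nz: "?E p \<noteq> 0" unfolding E using lin0 sE by (metis no_zero_divisors power_not_zero)
  have "subdegree (?E p) = ?k"
    unfolding E using lin lin0 s0 sE
    by (subst subdegree_mult) (auto simp: subdegree_eq_0 simp del: expand_poly_simps(7))
  moreover have "m \<le> subdegree (?E p)" using nz assms(2) by (intro subdegree_geI) auto
  ultimately show ?thesis by (simp add: order_divides)
qed simp

abbreviation cyclotomic_rat :: "nat \<Rightarrow> rat poly" where
  "cyclotomic_rat b \<equiv> map_poly of_int (cyclotomic b)"

lemma map_of_rat_cyclotomic_rat:
  "map_poly of_rat (cyclotomic_rat b) = (\<Prod>w\<in>primitive_roots b. [:- w, 1::complex:])"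
  unfolding cyclotomic_eq_prod[symmetric] by (simp add: poly_eq_iff coeff_map_poly)

text \<open>Division with remainder commutes with the extension of scalars: the image of
  \<open>Q mod P\<close> is a multiple of the image of \<open>P\<close> and, if nonzero, has smaller
  degree.\<close>

lemma map_of_rat_dvd_iff:
  fixes P Q :: "rat poly"
  shows "(map_poly of_rat P :: complex poly) dvd map_poly of_rat Q \<longleftrightarrow> P dvd Q"
proof
  let ?c = "map_poly of_rat :: rat poly \<Rightarrow> complex poly"
  have deg: "degree (?c a) = degree a" for a by (rule degree_map_poly) auto
  assume dvd: "?c P dvd ?c Q"
  have "Q = Q div P * P + Q mod P" by simp
  then have "?c Q = ?c (Q div P) * ?c P + ?c (Q mod P)"
    by (metis rat_hom.map_poly_hom_add rat_hom.map_poly_hom_mult)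
  then have d: "?c P dvd ?c (Q mod P)" using dvd by (metis dvd_add_right_iff dvd_triv_right)
  have "Q mod P = 0"
  proof (cases "P = 0")
    case True
    then show ?thesis using d by (simp add: map_poly_eq_0_iff)
  next
    case False
    show ?thesis
    proof (rule ccontr)
      assume nz: "Q mod P \<noteq> 0"
      then have "degree (?c P) \<le> degree (?c (Q mod P))"
        using d by (intro dvd_imp_degree_le) (auto simp: map_poly_eq_0_iff)
      then show False using degree_mod_less[OF False, of Q] nz by (simp add: deg)
    qed
  qed
  then show "P dvd Q" by (simp add: mod_eq_0_iff_dvd)
qed (auto simp: rat_hom.map_poly_hom elim!: dvdE)

text \<open>The linear factors are assembled over the complex numbers, and the divisibility then
  descends to the rationals.\<close>

lemma cyclotomic_power_dvd_of_expand:
  assumes "\<And>\<zeta> i. \<zeta> \<in> primitive_roots b \<Longrightarrow> i < m \<Longrightarrow> expand_rat \<zeta> P $ i = 0"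
  shows "cyclotomic_rat b ^ m dvd P"
proof -
  have "(\<Prod>w\<in>primitive_roots b. [:- w, 1:]) ^ m dvd (map_poly of_rat P :: complex poly)"
    by (intro prod_linear_power_dvd finite_primitive_roots linear_power_dvd_of_expand assms)
       (auto simp: primitive_roots_def power_0_left)
  then have "map_poly of_rat (cyclotomic_rat b ^ m) dvd (map_poly of_rat P :: complex poly)"
    by (simp only: rat_hom.map_poly_hom map_of_rat_cyclotomic_rat)
  then show ?thesis by (simp only: map_of_rat_dvd_iff)
qed

subsection \<open>Rational functions and their expansions\<close>

lemma to_fract_power [simp]: "to_fract (x ^ n) = to_fract x ^ n"
  by (induction n) simp_all

lemma of_qpoly_simps [simp]:
  "of_qpoly 0 = 0" "of_qpoly 1 = 1"
  "of_qpoly (P + Q) = of_qpoly P + of_qpoly Q"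
  "of_qpoly (P - Q) = of_qpoly P - of_qpoly Q"
  "of_qpoly (P * Q) = of_qpoly P * of_qpoly Q"
  "of_qpoly (- P) = - of_qpoly P"
  "of_qpoly (P ^ n) = of_qpoly P ^ n"
  by (simp_all add: of_qpoly_def const_hom.map_poly_hom)

lemma of_qpoly_eq_0_iff [simp]: "of_qpoly P = 0 \<longleftrightarrow> P = 0"
  by (simp add: of_qpoly_def map_poly_eq_0_iff)

lemma of_qpoly_of_nat [simp]: "of_qpoly (of_nat k) = of_nat k"
  by (induction k) simp_all

lemma qvar_eq_of_qpoly: "qvar = of_qpoly [:0, 1:]"
  by (simp add: qvar_def of_qpoly_def)

lemma qvar_nz [simp]: "qvar \<noteq> 0"
  by (simp add: qvar_eq_of_qpoly)

lemma of_qpoly_pCons: "of_qpoly (pCons a P) = of_qpoly [:a:] + qvar * of_qpoly P"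
proof -
  have "pCons a P = [:a:] + [:0, 1:] * P" by simp
  then show ?thesis unfolding qvar_eq_of_qpoly by (metis of_qpoly_simps(3,5))
qed

lemma cyclotomic_at_qvar: "cyclotomic_at b qvar = of_qpoly (cyclotomic_rat b)"
proof -
  have "poly (map_poly of_int p) qvar = of_qpoly (map_poly of_int p)" for p
  proof (induction p)
    case (pCons a p)
    have "[:of_int a:] = (of_int a :: rat poly)" by (simp add: of_int_poly)
    also have "of_qpoly (of_int a) = of_int a"
      by (cases a rule: int_cases2) simp_all
    finally have "of_qpoly [:of_int a:] = of_int a" .
    then show ?case
      using pCons of_qpoly_pCons[of "of_int a" "map_poly of_int p"] by simp
  qed simp
  then show ?thesis by (simp add: cyclotomic_at_def)
qed

lemma cyclotomic_rat_nz [simp]: "cyclotomic_rat b \<noteq> 0"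
  using map_of_rat_cyclotomic_rat[of b] finite_primitive_roots[of b]
  by (auto simp: prod_zero_iff)

lemma qvar_power_neq_1: "k > 0 \<Longrightarrow> 1 - qvar ^ k \<noteq> 0"
proof -
  assume "k > 0"
  then have "poly (1 - [:0, 1::rat:] ^ k) 0 \<noteq> 0" by (simp add: power_0_left)
  then have "1 - [:0, 1::rat:] ^ k \<noteq> 0" by fastforce
  then have "of_qpoly (1 - [:0, 1:] ^ k) \<noteq> 0" by (simp only: of_qpoly_eq_0_iff not_False_eq_True)
  then show ?thesis by (simp add: qvar_eq_of_qpoly)
qed

text \<open>Nonvanishing at the primitive roots is used in place of indivisibility by the cyclotomic
  polynomial, so that closure under products does not need its irreducibility.\<close>

definition unit_at :: "nat \<Rightarrow> rat poly \<Rightarrow> bool" where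
  "unit_at b V \<longleftrightarrow> (\<forall>\<zeta>\<in>primitive_roots b. poly (map_poly of_rat V) \<zeta> \<noteq> 0)"

lemma unit_at_1 [simp]: "unit_at b 1"
  by (simp add: unit_at_def)

lemma unit_at_mult: "unit_at b V \<Longrightarrow> unit_at b W \<Longrightarrow> unit_at b (V * W)"
  by (simp add: unit_at_def rat_hom.map_poly_hom)

lemma unit_at_nz:
  assumes "unit_at b V" "b > 0"
  shows "V \<noteq> 0"
  using assms primitive_roots_nonempty[of b] by (auto simp: unit_at_def)

lemma cyclotomic_rat_root:
  assumes "\<zeta> \<in> primitive_roots b"
  shows "poly (map_poly of_rat (cyclotomic_rat b)) \<zeta> = 0"
  unfolding map_of_rat_cyclotomic_rat using assms finite_primitive_roots by (auto simp: poly_prod)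

lemma unit_at_not_dvd:
  assumes "unit_at b V" "b > 0"
  shows "\<not> cyclotomic_rat b dvd V"
proof
  assume "cyclotomic_rat b dvd V"
  then obtain W where "V = cyclotomic_rat b * W" by (elim dvdE)
  moreover obtain \<zeta> where "\<zeta> \<in> primitive_roots b" using primitive_roots_nonempty[OF assms(2)] by blast
  ultimately show False
    using assms(1) cyclotomic_rat_root[of \<zeta> b] by (auto simp: unit_at_def rat_hom.map_poly_hom)
qed

section \<open>Multiples of powers of the cyclotomic polynomial\<close>

text \<open>For \<open>m = 0\<close> this is the polynomial ring in \<open>z\<close> and
  \<open>q\<close> localized at the polynomials in \<open>q\<close> that vanish at no primitive
  \<open>b\<close>-th root; for larger \<open>m\<close> it is the ideal generated there by
  \<open>\<Phi>\<^sub>b ^ m\<close>. Membership of \<open>A - B\<close> implies the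
  congruence.\<close>

definition cyclotomic_ideal :: "nat \<Rightarrow> nat \<Rightarrow> ratfun set" where
  "cyclotomic_ideal b m =
     {of_qpoly (cyclotomic_rat b) ^ m * to_fract P / of_qpoly V | P V. unit_at b V}"

lemma cong_cyclotomicI:
  assumes "A - B \<in> cyclotomic_ideal b m" "b > 0"
  shows "cong_cyclotomic b m A B"
proof -
  obtain P V where PV: "unit_at b V" "A - B = of_qpoly (cyclotomic_rat b) ^ m * to_fract P / of_qpoly V"
    using assms(1) unfolding cyclotomic_ideal_def by blast
  have "to_fract P \<in> laurent_polys"
    unfolding laurent_polys_def by (intro CollectI exI[of _ P] exI[of _ 0]) simp
  then show ?thesis
    unfolding cong_cyclotomic_def cyclotomic_at_qvar
    using PV unit_at_nz unit_at_not_dvd assms(2) by blast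
qed

lemma cyclotomic_ideal_add:
  assumes "A \<in> cyclotomic_ideal b m" "B \<in> cyclotomic_ideal b m" "b > 0"
  shows "A + B \<in> cyclotomic_ideal b m"
proof -
  let ?c = "of_qpoly (cyclotomic_rat b) ^ m" and ?lift = "map_poly (\<lambda>a. [:a:]) :: rat poly \<Rightarrow> rat poly poly"
  obtain P V where 1: "unit_at b V" "A = ?c * to_fract P / of_qpoly V"
    using assms(1) unfolding cyclotomic_ideal_def by blast
  obtain Q W where 2: "unit_at b W" "B = ?c * to_fract Q / of_qpoly W"
    using assms(2) unfolding cyclotomic_ideal_def by blast
  have nz: "of_qpoly V \<noteq> 0" "of_qpoly W \<noteq> 0"
    using 1 2 unit_at_nz[OF _ assms(3)] by auto
  have "A + B = ?c * to_fract (P * ?lift W + Q * ?lift V) / of_qpoly (V * W)"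
    using nz by (simp add: 1 2 field_simps flip: of_qpoly_def)
  then show ?thesis
    using unit_at_mult[OF 1(1) 2(1)] unfolding cyclotomic_ideal_def by blast
qed

lemma cyclotomic_ideal_mult:
  assumes "A \<in> cyclotomic_ideal b m" "B \<in> cyclotomic_ideal b k"
  shows "A * B \<in> cyclotomic_ideal b (m + k)"
proof -
  let ?c = "of_qpoly (cyclotomic_rat b)"
  obtain P V where 1: "unit_at b V" "A = ?c ^ m * to_fract P / of_qpoly V"
    using assms(1) unfolding cyclotomic_ideal_def by blast
  obtain Q W where 2: "unit_at b W" "B = ?c ^ k * to_fract Q / of_qpoly W"
    using assms(2) unfolding cyclotomic_ideal_def by blast
  have "A * B = ?c ^ (m + k) * to_fract (P * Q) / of_qpoly (V * W)"
    by (simp add: 1 2 power_add)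
  then show ?thesis
    using unit_at_mult[OF 1(1) 2(1)] unfolding cyclotomic_ideal_def by blast
qed

lemmas cyclotomic_ideal_mult_left = cyclotomic_ideal_mult[where m = 0, simplified]

lemma to_fract_in_cyclotomic_ideal: "to_fract P \<in> cyclotomic_ideal b 0"
  unfolding cyclotomic_ideal_def by (intro CollectI exI[of _ P] exI[of _ 1]) simp

lemma zero_in_cyclotomic_ideal [simp]: "0 \<in> cyclotomic_ideal b m"
  unfolding cyclotomic_ideal_def by (intro CollectI exI[of _ 0] exI[of _ 1]) simp

lemma cyclotomic_ideal_sum:
  assumes "\<And>i. i \<in> S \<Longrightarrow> f i \<in> cyclotomic_ideal b m" "b > 0"
  shows "sum f S \<in> cyclotomic_ideal b m"
  using assms(1) by (induction S rule: infinite_finite_induct) (auto intro: cyclotomic_ideal_add assms(2))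

lemma zvar_power_in_cyclotomic_ideal: "zvar ^ k \<in> cyclotomic_ideal b 0"
  unfolding zvar_def to_fract_power[symmetric] by (rule to_fract_in_cyclotomic_ideal)

section \<open>Power series expansions of rational functions of q\<close>

text \<open>This covers functions of \<open>q\<close> alone; powers of \<open>zvar\<close> are
  carried outside as factors. As the expansion of \<open>Q\<close> has nonzero constant term,
  \<open>F \<zeta>\<close> is the quotient of the two expansions at every primitive root.\<close>

definition has_expansion :: "nat \<Rightarrow> ratfun \<Rightarrow> (complex \<Rightarrow> complex fps) \<Rightarrow> bool" where
  "has_expansion b A F \<longleftrightarrow> (\<exists>P Q. unit_at b Q \<and> A = of_qpoly P / of_qpoly Q \<and>
     (\<forall>\<zeta>\<in>primitive_roots b. F \<zeta> * expand_rat \<zeta> Q = expand_rat \<zeta> P))"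

lemma has_expansion_of_qpoly: "has_expansion b (of_qpoly P) (\<lambda>\<zeta>. expand_rat \<zeta> P)"
  unfolding has_expansion_def by (intro exI[of _ P] exI[of _ 1]) simp

lemma has_expansion_add:
  assumes "has_expansion b A F" "has_expansion b B G" "b > 0"
  shows "has_expansion b (A + B) (\<lambda>\<zeta>. F \<zeta> + G \<zeta>)"
proof -
  obtain P Q where 1: "unit_at b Q" "A = of_qpoly P / of_qpoly Q"
    "\<And>\<zeta>. \<zeta> \<in> primitive_roots b \<Longrightarrow> F \<zeta> * expand_rat \<zeta> Q = expand_rat \<zeta> P"
    using assms(1) unfolding has_expansion_def by blast
  obtain R S where 2: "unit_at b S" "B = of_qpoly R / of_qpoly S"
    "\<And>\<zeta>. \<zeta> \<in> primitive_roots b \<Longrightarrow> G \<zeta> * expand_rat \<zeta> S = expand_rat \<zeta> R"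
    using assms(2) unfolding has_expansion_def by blast
  have "A + B = of_qpoly (P * S + R * Q) / of_qpoly (Q * S)"
    using unit_at_nz[OF 1(1) assms(3)] unit_at_nz[OF 2(1) assms(3)] by (simp add: 1 2 field_simps)
  moreover have "(F \<zeta> + G \<zeta>) * expand_rat \<zeta> (Q * S) = expand_rat \<zeta> (P * S + R * Q)"
    if "\<zeta> \<in> primitive_roots b" for \<zeta>
    by (simp add: rat_hom.map_poly_hom algebra_simps flip: 1(3)[OF that] 2(3)[OF that])
  ultimately show ?thesis
    unfolding has_expansion_def using unit_at_mult[OF 1(1) 2(1)] by blast
qed

lemma has_expansion_mult:
  assumes "has_expansion b A F" "has_expansion b B G"
  shows "has_expansion b (A * B) (\<lambda>\<zeta>. F \<zeta> * G \<zeta>)"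
proof -
  obtain P Q where 1: "unit_at b Q" "A = of_qpoly P / of_qpoly Q"
    "\<And>\<zeta>. \<zeta> \<in> primitive_roots b \<Longrightarrow> F \<zeta> * expand_rat \<zeta> Q = expand_rat \<zeta> P"
    using assms(1) unfolding has_expansion_def by blast
  obtain R S where 2: "unit_at b S" "B = of_qpoly R / of_qpoly S"
    "\<And>\<zeta>. \<zeta> \<in> primitive_roots b \<Longrightarrow> G \<zeta> * expand_rat \<zeta> S = expand_rat \<zeta> R"
    using assms(2) unfolding has_expansion_def by blast
  have "A * B = of_qpoly (P * R) / of_qpoly (Q * S)"
    by (simp add: 1 2)
  moreover have "(F \<zeta> * G \<zeta>) * expand_rat \<zeta> (Q * S) = expand_rat \<zeta> (P * R)"
    if "\<zeta> \<in> primitive_roots b" for \<zeta>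
    by (simp add: rat_hom.map_poly_hom flip: 1(3)[OF that] 2(3)[OF that])
  ultimately show ?thesis
    unfolding has_expansion_def using unit_at_mult[OF 1(1) 2(1)] by blast
qed

lemma has_expansion_inverse:
  assumes "has_expansion b A F" "\<And>\<zeta>. \<zeta> \<in> primitive_roots b \<Longrightarrow> F \<zeta> $ 0 \<noteq> 0"
  shows "has_expansion b (inverse A) (\<lambda>\<zeta>. inverse (F \<zeta>))"
proof -
  obtain P Q where 1: "unit_at b Q" "A = of_qpoly P / of_qpoly Q"
    "\<And>\<zeta>. \<zeta> \<in> primitive_roots b \<Longrightarrow> F \<zeta> * expand_rat \<zeta> Q = expand_rat \<zeta> P"
    using assms(1) unfolding has_expansion_def by blast
  \<comment> \<open>The old numerator becomes the new denominator. Its value at \<zeta> is the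
    constant term of \<open>F \<zeta>\<close> times the nonzero value of \<open>Q\<close>.\<close>
  have "unit_at b P"
    unfolding unit_at_def
  proof
    fix \<zeta> assume \<zeta>: "\<zeta> \<in> primitive_roots b"
    have "poly (map_poly of_rat P) \<zeta> = (F \<zeta> * expand_rat \<zeta> Q) $ 0"
      by (simp only: 1(3)[OF \<zeta>] expand_poly_nth_0)
    then show "poly (map_poly of_rat P) \<zeta> \<noteq> 0"
      using 1(1) \<zeta> assms(2)[OF \<zeta>] by (simp add: unit_at_def)
  qed
  moreover have "inverse A = of_qpoly Q / of_qpoly P" by (simp add: 1)
  moreover have "inverse (F \<zeta>) * expand_rat \<zeta> P = expand_rat \<zeta> Q" if "\<zeta> \<in> primitive_roots b" for \<zeta>
    using inverse_mult_eq_1[OF assms(2)[OF that]]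
    by (simp flip: 1(3)[OF that] mult.assoc)
  ultimately show ?thesis
    unfolding has_expansion_def by blast
qed

lemma has_expansion_of_nat: "has_expansion b (of_nat k) (\<lambda>_. of_nat k)"
proof -
  have "expand_rat \<zeta> (of_nat k) = of_nat k" for \<zeta>
    by (induction k) (simp_all add: rat_hom.map_poly_hom)
  then show ?thesis
    using has_expansion_of_qpoly[of b "of_nat k"] by simp
qed

lemma has_expansion_1: "has_expansion b 1 (\<lambda>_. 1)"
  using has_expansion_of_nat[of b 1] by simp

lemma has_expansion_uminus:
  assumes "has_expansion b A F"
  shows "has_expansion b (- A) (\<lambda>\<zeta>. - F \<zeta>)"
proof -
  have "has_expansion b (- 1) (\<lambda>_. - 1)"
    using has_expansion_of_qpoly[of b "- 1"] by (simp add: rat_hom.map_poly_hom)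
  from has_expansion_mult[OF this assms] show ?thesis by simp
qed

lemma has_expansion_diff:
  assumes "has_expansion b A F" "has_expansion b B G" "b > 0"
  shows "has_expansion b (A - B) (\<lambda>\<zeta>. F \<zeta> - G \<zeta>)"
  using has_expansion_add[OF assms(1) has_expansion_uminus[OF assms(2)] assms(3)] by simp

lemma has_expansion_prod:
  assumes "\<And>i. i \<in> S \<Longrightarrow> has_expansion b (A i) (F i)"
  shows "has_expansion b (\<Prod>i\<in>S. A i) (\<lambda>\<zeta>. \<Prod>i\<in>S. F i \<zeta>)"
  using assms
  by (induction S rule: infinite_finite_induct) (auto intro: has_expansion_mult has_expansion_1)

lemma has_expansion_sum:
  assumes "\<And>i. i \<in> S \<Longrightarrow> has_expansion b (A i) (F i)" "b > 0"
  shows "has_expansion b (\<Sum>i\<in>S. A i) (\<lambda>\<zeta>. \<Sum>i\<in>S. F i \<zeta>)"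
  using assms(1) has_expansion_of_nat[of b 0]
  by (induction S rule: infinite_finite_induct) (auto intro: has_expansion_add assms(2))

lemma has_expansion_power:
  assumes "has_expansion b A F"
  shows "has_expansion b (A ^ k) (\<lambda>\<zeta>. F \<zeta> ^ k)"
  using has_expansion_prod[of "{..<k}" b "\<lambda>_. A" "\<lambda>_. F"] assms by simp

abbreviation expand_qpower :: "complex \<Rightarrow> nat \<Rightarrow> complex fps" where
  "expand_qpower \<zeta> k \<equiv> fps_const (\<zeta> ^ k) * fps_exp (of_nat k)"

lemma has_expansion_qpower: "has_expansion b (qvar ^ k) (\<lambda>\<zeta>. expand_qpower \<zeta> k)"
proof -
  have "has_expansion b qvar (\<lambda>\<zeta>. fps_const \<zeta> * fps_exp 1)"
    using has_expansion_of_qpoly[of b "[:0, 1:]"] by (simp add: qvar_eq_of_qpoly)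
  from has_expansion_power[OF this, of k] show ?thesis
    by (simp add: power_mult_distrib fps_exp_power_mult fps_const_power)
qed

text \<open>Multiplication by the expansion of the denominator keeps the low coefficients zero, so
  they vanish for the numerator as well.\<close>

lemma has_expansion_imp_cyclotomic_ideal:
  assumes "has_expansion b A F" "\<And>\<zeta> i. \<zeta> \<in> primitive_roots b \<Longrightarrow> i < m \<Longrightarrow> F \<zeta> $ i = 0"
  shows "A \<in> cyclotomic_ideal b m"
proof -
  obtain P Q where 1: "unit_at b Q" "A = of_qpoly P / of_qpoly Q"
    "\<And>\<zeta>. \<zeta> \<in> primitive_roots b \<Longrightarrow> F \<zeta> * expand_rat \<zeta> Q = expand_rat \<zeta> P"
    using assms(1) unfolding has_expansion_def by blast
  have "cyclotomic_rat b ^ m dvd P"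
  proof (rule cyclotomic_power_dvd_of_expand)
    fix \<zeta> i assume "\<zeta> \<in> primitive_roots b" "i < m"
    then show "expand_rat \<zeta> P $ i = 0"
      using assms(2) by (auto simp: fps_mult_nth intro!: sum.neutral simp flip: 1(3))
  qed
  then obtain R where "P = cyclotomic_rat b ^ m * R" by (elim dvdE)
  then have "A = of_qpoly (cyclotomic_rat b) ^ m * of_qpoly R / of_qpoly Q" by (simp add: 1(2))
  then show ?thesis
    unfolding cyclotomic_ideal_def of_qpoly_def[of R] using 1(1) by blast
qed

lemma has_expansion_imp_integral: "has_expansion b A F \<Longrightarrow> A \<in> cyclotomic_ideal b 0"
  by (rule has_expansion_imp_cyclotomic_ideal) simp_all

section \<open>The factor 1 - q^b\<close>

text \<open>The expansion of \<open>1 - qvar ^ b\<close> is 1 - exp (b X), with constant term 0 and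
  linear coefficient \<open>- b\<close>. A zero of the cofactor at \<zeta> would make the linear
  coefficient vanish, so \<open>\<Phi>\<^sub>b\<close> divides exactly once.\<close>

lemma one_minus_qpower_eq_cyclotomic:
  assumes "b > 0"
  obtains W where "unit_at b W" "1 - qvar ^ b = of_qpoly (cyclotomic_rat b * W)"
proof -
  let ?P = "1 - [:0, 1::rat:] ^ b"
  have E: "expand_rat \<zeta> ?P = 1 - fps_exp (of_nat b)" if "\<zeta> \<in> primitive_roots b" for \<zeta>
    using primitive_root_power_eq_1_iff[OF that, of b]
    by (simp add: rat_hom.map_poly_hom expand_poly_def fps_const_hom.map_poly_hom
        power_mult_distrib fps_exp_power_mult fps_const_power)
  have "cyclotomic_rat b ^ 1 dvd ?P"
    by (rule cyclotomic_power_dvd_of_expand) (simp add: E)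
  then obtain W where W: "?P = cyclotomic_rat b * W" by auto
  have "unit_at b W"
    unfolding unit_at_def
  proof (intro ballI notI)
    fix \<zeta> assume \<zeta>: "\<zeta> \<in> primitive_roots b" and "poly (map_poly of_rat W) \<zeta> = 0"
    then have "(expand_rat \<zeta> (cyclotomic_rat b) * expand_rat \<zeta> W) $ 1 = 0"
      using cyclotomic_rat_root[OF \<zeta>] by (simp add: fps_mult_nth)
    also have "expand_rat \<zeta> (cyclotomic_rat b) * expand_rat \<zeta> W = expand_rat \<zeta> ?P"
      by (simp only: W rat_hom.map_poly_hom expand_poly_simps)
    finally show False using assms by (simp add: E[OF \<zeta>])
  qed
  moreover have "1 - qvar ^ b = of_qpoly ?P"
    by (simp add: qvar_eq_of_qpoly)
  ultimately show ?thesis using that W by metis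
qed

text \<open>Division by \<open>1 - qvar ^ b\<close> lowers the exponent of the modulus by just one;
  this is how a comparison modulo \<open>\<Phi>\<^sub>b ^ 3\<close> yields the first
  congruence.\<close>

lemma divide_one_minus_qpower:
  assumes "A \<in> cyclotomic_ideal b (m + k)" "b > 0"
  shows "A / (1 - qvar ^ b) ^ k \<in> cyclotomic_ideal b m"
proof -
  obtain W where W: "unit_at b W" "1 - qvar ^ b = of_qpoly (cyclotomic_rat b * W)"
    using one_minus_qpower_eq_cyclotomic[OF assms(2)] .
  obtain P V where 1: "unit_at b V" "A = of_qpoly (cyclotomic_rat b) ^ (m + k) * to_fract P / of_qpoly V"
    using assms(1) unfolding cyclotomic_ideal_def by blast
  have "unit_at b (W ^ k)" for k using W(1) by (induction k) (simp_all add: unit_at_mult)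
  then have "unit_at b (V * W ^ k)" using 1(1) unit_at_mult by blast
  moreover have "A / (1 - qvar ^ b) ^ k =
    of_qpoly (cyclotomic_rat b) ^ m * to_fract P / of_qpoly (V * W ^ k)"
    by (simp add: 1(2) W(2) power_add power_mult_distrib)
  ultimately show ?thesis unfolding cyclotomic_ideal_def by blast
qed

lemma one_minus_qpower_in_cyclotomic_ideal: "(1 - qvar ^ b) ^ k \<in> cyclotomic_ideal b k" if "b > 0"
proof -
  have "1 - qvar ^ b \<in> cyclotomic_ideal b 1"
    by (rule has_expansion_imp_cyclotomic_ideal[OF has_expansion_diff[OF has_expansion_1 has_expansion_qpower that]])
       (auto simp: primitive_root_power_eq_1_iff)
  then show ?thesis
    using has_expansion_imp_integral[OF has_expansion_1]
    by (induction k) (use cyclotomic_ideal_mult in fastforce)+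
qed

subsection \<open>Second-order logarithmic coefficients\<close>

text \<open>\<open>ln_coeff1\<close> and \<open>ln_coeff2\<close> are the coefficients of X and X^2
  in the formal logarithm of \<open>F\<close> divided by its constant term, and hence additive on
  products.\<close>

definition ln_coeff1 :: "'a::field fps \<Rightarrow> 'a" where
  "ln_coeff1 F = F $ 1 / F $ 0"

definition ln_coeff2 :: "'a::field fps \<Rightarrow> 'a" where
  "ln_coeff2 F = F $ 2 / F $ 0 - (F $ 1 / F $ 0) ^ 2 / 2"

lemma fps_nth_1_conv_ln_coeff: "F $ 0 \<noteq> 0 \<Longrightarrow> F $ 1 = F $ 0 * ln_coeff1 F"
  by (simp add: ln_coeff1_def)

lemma fps_nth_2_conv_ln_coeff:
  fixes F :: "'a::field_char_0 fps"
  shows "F $ 0 \<noteq> 0 \<Longrightarrow> F $ 2 = F $ 0 * (ln_coeff2 F + ln_coeff1 F ^ 2 / 2)"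
  by (simp add: ln_coeff1_def ln_coeff2_def)

lemma ln_coeff_mult:
  fixes F G :: "'a::field_char_0 fps"
  assumes "F $ 0 \<noteq> 0" "G $ 0 \<noteq> 0"
  shows "ln_coeff1 (F * G) = ln_coeff1 F + ln_coeff1 G"
    and "ln_coeff2 (F * G) = ln_coeff2 F + ln_coeff2 G"
proof -
  have "(F * G) $ 1 = F $ 0 * G $ 1 + F $ 1 * G $ 0"
    and "(F * G) $ 2 = F $ 0 * G $ 2 + F $ 1 * G $ 1 + F $ 2 * G $ 0"
    by (simp_all add: fps_mult_nth numeral_2_eq_2)
  then show "ln_coeff1 (F * G) = ln_coeff1 F + ln_coeff1 G"
    and "ln_coeff2 (F * G) = ln_coeff2 F + ln_coeff2 G"
    using assms by (simp_all add: ln_coeff1_def ln_coeff2_def field_simps power2_eq_square)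
qed

lemma prod_fps_nth_0: "(\<Prod>i\<in>S. F i) $ 0 = (\<Prod>i\<in>S. F i $ 0)" for F :: "'b \<Rightarrow> 'a::comm_ring_1 fps"
  by (induction S rule: infinite_finite_induct) simp_all

lemma ln_coeff_1 [simp]: "ln_coeff1 1 = 0" "ln_coeff2 1 = 0"
  by (simp_all add: ln_coeff1_def ln_coeff2_def)

lemma ln_coeff_prod:
  fixes F :: "'b \<Rightarrow> 'a::field_char_0 fps"
  assumes "\<And>i. i \<in> S \<Longrightarrow> F i $ 0 \<noteq> 0"
  shows "ln_coeff1 (\<Prod>i\<in>S. F i) = (\<Sum>i\<in>S. ln_coeff1 (F i))"
    and "ln_coeff2 (\<Prod>i\<in>S. F i) = (\<Sum>i\<in>S. ln_coeff2 (F i))"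
proof -
  have "ln_coeff1 (\<Prod>i\<in>S. F i) = (\<Sum>i\<in>S. ln_coeff1 (F i)) \<and>
    ln_coeff2 (\<Prod>i\<in>S. F i) = (\<Sum>i\<in>S. ln_coeff2 (F i))"
    using assms
    by (induction S rule: infinite_finite_induct)
       (simp_all add: ln_coeff_mult prod_fps_nth_0 prod_zero_iff)
  then show "ln_coeff1 (\<Prod>i\<in>S. F i) = (\<Sum>i\<in>S. ln_coeff1 (F i))"
    and "ln_coeff2 (\<Prod>i\<in>S. F i) = (\<Sum>i\<in>S. ln_coeff2 (F i))" by auto
qed

lemma ln_coeff_const_exp:
  fixes a :: "'a::field_char_0"
  assumes "c \<noteq> 0"
  shows "ln_coeff1 (fps_const c * fps_exp a) = a" "ln_coeff2 (fps_const c * fps_exp a) = 0"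
  using assms by (simp_all add: ln_coeff1_def ln_coeff2_def fact_numeral)

text \<open>The exponent \<open>a\<close> enters only as the factors \<open>a\<close> and
  \<open>a ^ 2\<close>; the rest depends on \<open>w\<close> alone and can be summed over the roots
  of unity.\<close>

lemma ln_coeff_one_minus_exp:
  fixes w a :: "'a::field_char_0"
  assumes "w \<noteq> 1"
  shows "ln_coeff1 (1 - fps_const w * fps_exp a) = a * (- w / (1 - w))"
    and "ln_coeff2 (1 - fps_const w * fps_exp a) = a ^ 2 * (- w / (2 * (1 - w) ^ 2))"
proof -
  have "1 - w \<noteq> 0" using assms by simp
  then show "ln_coeff1 (1 - fps_const w * fps_exp a) = a * (- w / (1 - w))"
    and "ln_coeff2 (1 - fps_const w * fps_exp a) = a ^ 2 * (- w / (2 * (1 - w) ^ 2))"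
    by (simp_all add: ln_coeff1_def ln_coeff2_def fact_numeral divide_simps)
       (simp add: algebra_simps power2_eq_square)
qed

section \<open>Sums over roots of unity\<close>

text \<open>Put t = exp X in the factorization of 1 - t^b over all \<open>b\<close>-th roots of
  unity and cancel the factor 1 - exp X of \<open>u = 0\<close>, which is nonzero in an integral
  domain.\<close>

lemma prod_one_minus_roots_of_unity:
  fixes \<zeta> :: complex
  assumes "\<zeta> \<in> primitive_roots b"
  shows "(\<Prod>u\<in>{1..<b}. 1 - fps_const (\<zeta> ^ u) * fps_exp 1) = (\<Sum>i<b. fps_exp (of_nat i))"
proof -
  have b: "b > 0" using assms by (simp add: primitive_roots_def)
  have nz: "\<zeta> \<noteq> 0" using assms by (auto simp: primitive_roots_def power_0_left)
  let ?R = "{w::complex. w ^ b = 1}"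
  have "inj_on (\<lambda>u. \<zeta> ^ u) {..<b}"
  proof (rule linorder_inj_onI)
    fix u v assume uv: "u < v" "v \<in> {..<b}"
    show "\<zeta> ^ u \<noteq> \<zeta> ^ v"
    proof
      have "\<zeta> ^ u * \<zeta> ^ (v - u) = \<zeta> ^ v" using uv by (simp flip: power_add)
      moreover assume "\<zeta> ^ u = \<zeta> ^ v"
      ultimately have "\<zeta> ^ u * \<zeta> ^ (v - u) = \<zeta> ^ u * 1" by simp
      then have "\<zeta> ^ (v - u) = 1" using nz by simp
      then have "b dvd v - u" using primitive_root_power_eq_1_iff[OF assms] by simp
      then show False using uv by (auto dest: dvd_imp_le)
    qed
  qed auto
  moreover have "(\<lambda>u. \<zeta> ^ u) ` {..<b} = ?R"
  proof (rule card_subset_eq)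
    show "finite ?R" using finite_roots_unity[of b, where ?'a = complex] b by simp
    show "(\<lambda>u. \<zeta> ^ u) ` {..<b} \<subseteq> ?R"
      using primitive_root_power_eq_1_iff[OF assms] by (auto simp flip: power_mult)
    show "card ((\<lambda>u. \<zeta> ^ u) ` {..<b}) = card ?R"
      using calculation card_roots_unity_eq[of b] b by (simp add: card_image)
  qed
  ultimately have bij: "bij_betw (\<lambda>u. \<zeta> ^ u) {..<b} ?R" by (simp add: bij_betw_def)
  \<comment> \<open>This is the reversal of the usual factorization: for nonzero \<open>t\<close>
    each factor is \<open>t * (1 / t - w)\<close>, and \<open>t = 0\<close> is checked
    separately.\<close>
  have poly: "(\<Prod>w\<in>?R. [:1, - w:]) = 1 - [:0, 1:] ^ b"
  proof (rule poly_ext)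
    fix t :: complex
    show "poly (\<Prod>w\<in>?R. [:1, - w:]) t = poly (1 - [:0, 1:] ^ b) t"
    proof (cases "t = 0")
      case False
      have "poly (\<Prod>w\<in>?R. [:1, - w:]) t = (\<Prod>w\<in>?R. t * (1 / t - w))"
        unfolding poly_prod using False by (intro prod.cong) (simp_all add: field_simps)
      also have "\<dots> = t ^ b * ((1 / t) ^ b - 1)"
        using prod_nth_roots[OF b, of 1 "1 / t"] card_roots_unity_eq[of b] b
        by (simp add: prod.distrib)
      finally show ?thesis using False by (simp add: power_divide right_diff_distrib)
    qed (use b in \<open>simp add: poly_prod power_0_left\<close>)
  qed
  have hom: "expand_poly 1 (prod f S) = (\<Prod>i\<in>S. expand_poly 1 (f i))" for f :: "complex \<Rightarrow> _" and S
    by (induction S rule: infinite_finite_induct) simp_all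
  \<comment> \<open>Expansion at 1 is the substitution of exp X for the polynomial variable.\<close>
  have "(\<Prod>u<b. 1 - fps_const (\<zeta> ^ u) * fps_exp 1) = (\<Prod>w\<in>?R. expand_poly 1 [:1, - w:])"
    using prod.reindex_bij_betw[OF bij, of "\<lambda>w. expand_poly 1 [:1, - w:]"]
    by (simp add: mult.commute flip: fps_const_neg)
  also have "\<dots> = expand_poly 1 (1 - [:0, 1:] ^ b)"
    using poly hom by metis
  also have "\<dots> = 1 - fps_exp 1 ^ b"
    by (simp only: diff_conv_add_uminus expand_poly_simps) simp
  also have "\<dots> = (1 - fps_exp 1) * (\<Sum>i<b. fps_exp 1 ^ i)"
    by (rule one_diff_power_eq)
  also have "(\<Sum>i<b. fps_exp 1 ^ i) = (\<Sum>i<b. fps_exp (of_nat i :: complex))"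
    by (simp add: fps_exp_power_mult)
  also have "(\<Prod>u<b. 1 - fps_const (\<zeta> ^ u) * fps_exp 1) =
    (1 - fps_exp 1) * (\<Prod>u\<in>{1..<b}. 1 - fps_const (\<zeta> ^ u) * fps_exp 1)"
    using b by (simp add: lessThan_atLeast0 prod.atLeast_Suc_lessThan)
  finally have "(1 - fps_exp 1) * (\<Prod>u\<in>{1..<b}. 1 - fps_const (\<zeta> ^ u) * fps_exp 1) =
    (1 - fps_exp 1) * (\<Sum>i<b. fps_exp (of_nat i))" .
  moreover have "1 - fps_exp 1 \<noteq> (0 :: complex fps)"
    by (metis eq_iff_diff_eq_0 fps_exp_eq_1_iff zero_neq_one)
  ultimately show ?thesis by (simp only: mult_cancel_left simp_thms)
qed

lemma sum_of_nat_squares: "6 * (\<Sum>i<b. of_nat i ^ 2 :: 'a::field_char_0) = (of_nat b - 1) * of_nat b * (2 * of_nat b - 1)"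
  by (induction b) (simp_all add: algebra_simps power2_eq_square)

lemma sum_of_nats: "2 * (\<Sum>i<b. of_nat i :: 'a::field_char_0) = (of_nat b - 1) * of_nat b"
  by (induction b) (simp_all add: algebra_simps)

text \<open>The first two sums are the logarithmic coefficients of the product over
  \<open>u\<close>, computed from 1 + exp X + ... + exp ((b - 1) X). In the third, the weight is
  invariant under \<open>u \<mapsto> b - u\<close>, so \<open>u\<close> may be replaced by its mean
  \<open>b / 2\<close>.\<close>

lemma root_of_unity_sums:
  fixes \<zeta> :: complex
  assumes \<zeta>: "\<zeta> \<in> primitive_roots b"
  shows "(\<Sum>u\<in>{1..<b}. - (\<zeta> ^ u) / (1 - \<zeta> ^ u)) = (of_nat b - 1) / 2"
    and "(\<Sum>u\<in>{1..<b}. - (\<zeta> ^ u) / (2 * (1 - \<zeta> ^ u) ^ 2)) = (of_nat b ^ 2 - 1) / 24"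
    and "(\<Sum>u\<in>{1..<b}. of_nat u * (- (\<zeta> ^ u) / (2 * (1 - \<zeta> ^ u) ^ 2))) =
           of_nat b * (of_nat b ^ 2 - 1) / 48"
proof -
  have b: "b > 0" using \<zeta> by (simp add: primitive_roots_def)
  have nz: "\<zeta> \<noteq> 0" using \<zeta> by (auto simp: primitive_roots_def power_0_left)
  have ne1: "\<zeta> ^ u \<noteq> 1" if "u \<in> {1..<b}" for u
    using that \<zeta> by (auto simp: primitive_roots_def)
  let ?P = "\<Prod>u\<in>{1..<b}. 1 - fps_const (\<zeta> ^ u) * fps_exp 1" and ?S = "\<Sum>i<b. fps_exp (of_nat i :: complex)"
  let ?B = "of_nat b :: complex"
  have S: "?S $ 0 = ?B" "?S $ 1 = ?B * (?B - 1) / 2" "?S $ 2 = ?B * (?B - 1) * (2 * ?B - 1) / 12"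
    using sum_of_nats[of b, where ?'a = complex] sum_of_nat_squares[of b, where ?'a = complex]
    by (simp_all add: fps_sum_nth fact_numeral mult_ac flip: sum_divide_distrib)
  have "(\<Sum>u\<in>{1..<b}. - (\<zeta> ^ u) / (1 - \<zeta> ^ u)) = ln_coeff1 ?P"
    using ne1 by (subst ln_coeff_prod) (auto simp: ln_coeff_one_minus_exp)
  also have "\<dots> = ln_coeff1 ?S" by (simp only: prod_one_minus_roots_of_unity[OF \<zeta>])
  also have "\<dots> = (?B - 1) / 2" unfolding ln_coeff1_def S using b by simp
  finally show "(\<Sum>u\<in>{1..<b}. - (\<zeta> ^ u) / (1 - \<zeta> ^ u)) = (of_nat b - 1) / 2" .
  have "(\<Sum>u\<in>{1..<b}. - (\<zeta> ^ u) / (2 * (1 - \<zeta> ^ u) ^ 2)) = ln_coeff2 ?P"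
    using ne1 by (subst ln_coeff_prod) (auto simp: ln_coeff_one_minus_exp)
  also have "\<dots> = ln_coeff2 ?S" by (simp only: prod_one_minus_roots_of_unity[OF \<zeta>])
  also have "\<dots> = (?B ^ 2 - 1) / 24"
    unfolding ln_coeff2_def S using b by (simp add: field_simps power2_eq_square)
  finally show 2: "(\<Sum>u\<in>{1..<b}. - (\<zeta> ^ u) / (2 * (1 - \<zeta> ^ u) ^ 2)) = (of_nat b ^ 2 - 1) / 24" .
  let ?e = "\<lambda>u. - (\<zeta> ^ u) / (2 * (1 - \<zeta> ^ u) ^ 2)"
  \<comment> \<open>The map \<open>u \<mapsto> b - u\<close> inverts \<open>\<zeta> ^ u\<close>, and
    w / (1 - w)^2 is unchanged under w \<mapsto> 1 / w.\<close>
  have sym: "?e (b - u) = ?e u" if "u \<in> {1..<b}" for u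
  proof -
    have "\<zeta> ^ (b - u) * \<zeta> ^ u = 1"
      using that primitive_root_power_eq_1_iff[OF \<zeta>, of b] by (simp flip: power_add)
    then have inv: "\<zeta> ^ (b - u) = 1 / \<zeta> ^ u" using nz by (simp add: field_simps)
    have "1 - \<zeta> ^ u \<noteq> 0" "\<zeta> ^ u \<noteq> 0" "\<zeta> ^ u - 1 \<noteq> 0" using ne1[OF that] nz by auto
    moreover have "- (1 / w) / (2 * (1 - 1 / w) ^ 2) = - w / (2 * (1 - w) ^ 2)"
      if "1 - w \<noteq> 0" "w \<noteq> 0" "w - 1 \<noteq> 0" for w :: complex
      using that by (simp add: divide_simps) (simp add: algebra_simps power2_eq_square)
    ultimately show ?thesis unfolding inv by blast
  qed
  have "(\<Sum>u\<in>{1..<b}. of_nat u * ?e u) = (\<Sum>u\<in>{1..<b}. of_nat (b - u) * ?e (b - u))"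
    by (rule sum.reindex_bij_witness[where i = "\<lambda>u. b - u" and j = "\<lambda>u. b - u"]) auto
  also have "\<dots> = (\<Sum>u\<in>{1..<b}. ?B * ?e u - of_nat u * ?e u)"
  proof (rule sum.cong)
    fix u assume u: "u \<in> {1..<b}"
    then show "of_nat (b - u) * ?e (b - u) = ?B * ?e u - of_nat u * ?e u"
      unfolding sym[OF u] by (simp only: of_nat_diff[of u b] left_diff_distrib atLeastLessThan_iff less_imp_le)
  qed simp
  also have "\<dots> = ?B * (\<Sum>u\<in>{1..<b}. ?e u) - (\<Sum>u\<in>{1..<b}. of_nat u * ?e u)"
    by (simp only: sum_subtractf sum_distrib_left)
  finally show "(\<Sum>u\<in>{1..<b}. of_nat u * ?e u) = of_nat b * (of_nat b ^ 2 - 1) / 48"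
    unfolding 2 by (simp add: field_simps)
qed

section \<open>The part of the q-binomial prime to the cyclotomic polynomial\<close>

text \<open>The exponents are the integers strictly between \<open>b * m\<close> and
  \<open>b * (m + j)\<close> not divisible by \<open>b\<close>, that is, those whose factors do not
  vanish at \<zeta>. The numerator of the reduced \<open>q\<close>-binomial uses \<open>m\<close>,
  its denominator uses 0.\<close>

definition block_expansion :: "nat \<Rightarrow> complex \<Rightarrow> nat \<Rightarrow> nat \<Rightarrow> complex fps" where
  "block_expansion b \<zeta> m j = (\<Prod>s<j. \<Prod>u\<in>{1..<b}. 1 - expand_qpower \<zeta> (b * (m + s) + u))"

lemma block_expansion_coeffs:
  assumes \<zeta>: "\<zeta> \<in> primitive_roots b"
  shows "block_expansion b \<zeta> m j $ 0 = block_expansion b \<zeta> 0 j $ 0"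
    and "block_expansion b \<zeta> m j $ 0 \<noteq> 0"
    and "ln_coeff1 (block_expansion b \<zeta> m j) =
      ln_coeff1 (block_expansion b \<zeta> 0 j) + of_nat (b * m * j) * (of_nat b - 1) / 2"
    and "ln_coeff2 (block_expansion b \<zeta> m j) = ln_coeff2 (block_expansion b \<zeta> 0 j) +
      of_nat b ^ 2 * (of_nat ((m + j) * j * m) * (of_nat b ^ 2 - 1) / 24)"
proof -
  let ?B = "of_nat b :: complex" and ?m = "of_nat m :: complex"
  have \<zeta>b: "\<zeta> ^ b = 1" using \<zeta> by (simp add: primitive_roots_def)
  have ne1: "\<zeta> ^ u \<noteq> 1" if "u \<in> {1..<b}" for u
    using that \<zeta> by (auto simp: primitive_roots_def)
  \<comment> \<open>As \<open>\<zeta> ^ b = 1\<close>, the constant in front of each exponential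
    depends on \<open>u\<close> only; \<open>m\<close> and \<open>s\<close> survive only in the
    exponent. Hence the constant term does not depend on \<open>m\<close>.\<close>
  have eq: "block_expansion b \<zeta> m j =
    (\<Prod>s<j. \<Prod>u\<in>{1..<b}. 1 - fps_const (\<zeta> ^ u) * fps_exp (?B * (of_nat m + of_nat s) + of_nat u))" for m
    unfolding block_expansion_def by (simp add: power_add power_mult \<zeta>b)
  have nz: "(\<Prod>u\<in>{1..<b}. 1 - fps_const (\<zeta> ^ u) * fps_exp (a u)) $ 0 \<noteq> 0" for a
    using ne1 by (auto simp: prod_fps_nth_0)
  show "block_expansion b \<zeta> m j $ 0 = block_expansion b \<zeta> 0 j $ 0"
    unfolding eq by (simp add: prod_fps_nth_0)
  show "block_expansion b \<zeta> m j $ 0 \<noteq> 0"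
    unfolding eq using ne1 by (auto simp: prod_fps_nth_0)
  let ?a = "\<lambda>u. - (\<zeta> ^ u) / (1 - \<zeta> ^ u)" and ?e = "\<lambda>u. - (\<zeta> ^ u) / (2 * (1 - \<zeta> ^ u) ^ 2)"
  have "ln_coeff1 (block_expansion b \<zeta> m j) =
    (\<Sum>s<j. \<Sum>u\<in>{1..<b}. (?B * (of_nat m + of_nat s) + of_nat u) * ?a u)" for m
    unfolding eq using nz ne1
    by (subst ln_coeff_prod, simp, intro sum.cong refl, subst ln_coeff_prod)
       (auto simp: ln_coeff_one_minus_exp)
  note l1 = this
  have "ln_coeff1 (block_expansion b \<zeta> m j) - ln_coeff1 (block_expansion b \<zeta> 0 j) =
    (\<Sum>s<j. \<Sum>u\<in>{1..<b}. ?B * ?m * ?a u)"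
    unfolding l1 sum_subtractf[symmetric]
    by (intro sum.cong refl, subst left_diff_distrib[symmetric]) (simp add: algebra_simps)
  also have "\<dots> = of_nat (b * m * j) * (?B - 1) / 2"
    unfolding sum_distrib_left[symmetric] root_of_unity_sums(1)[OF \<zeta>] by simp
  finally show "ln_coeff1 (block_expansion b \<zeta> m j) =
      ln_coeff1 (block_expansion b \<zeta> 0 j) + of_nat (b * m * j) * (?B - 1) / 2"
    by (simp only: diff_eq_eq add.commute)
  have "ln_coeff2 (block_expansion b \<zeta> m j) =
    (\<Sum>s<j. \<Sum>u\<in>{1..<b}. (?B * (of_nat m + of_nat s) + of_nat u) ^ 2 * ?e u)" for m
    unfolding eq using nz ne1
    by (subst ln_coeff_prod, simp, intro sum.cong refl, subst ln_coeff_prod)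
       (auto simp: ln_coeff_one_minus_exp)
  note l2 = this
  \<comment> \<open>The difference of the squared exponents is \<open>(b * (m + s) + u)^2 - (b * s +
    u)^2 = b^2 * (m^2 + 2 * m * s) + 2 * b * m * u\<close>.\<close>
  have "ln_coeff2 (block_expansion b \<zeta> m j) - ln_coeff2 (block_expansion b \<zeta> 0 j) =
    (\<Sum>s<j. \<Sum>u\<in>{1..<b}. ?B ^ 2 * (?m ^ 2 + 2 * ?m * of_nat s) * ?e u + 2 * ?B * ?m * (of_nat u * ?e u))"
    unfolding l2 sum_subtractf[symmetric]
    by (intro sum.cong refl, subst left_diff_distrib[symmetric], subst mult.assoc[symmetric],
        subst distrib_right[symmetric], rule arg_cong2[where f = "(*)", OF _ refl])
       (simp add: algebra_simps power2_eq_square)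
  also have "\<dots> = (\<Sum>s<j. ?B ^ 2 * (?B ^ 2 - 1) / 24 * (?m ^ 2 + ?m + ?m * 2 * of_nat s))"
  proof (rule sum.cong[OF refl])
    fix s
    show "(\<Sum>u\<in>{1..<b}. ?B ^ 2 * (?m ^ 2 + 2 * ?m * of_nat s) * ?e u + 2 * ?B * ?m * (of_nat u * ?e u)) =
        ?B ^ 2 * (?B ^ 2 - 1) / 24 * (?m ^ 2 + ?m + ?m * 2 * of_nat s)"
      unfolding sum.distrib sum_distrib_left[symmetric] root_of_unity_sums(2,3)[OF \<zeta>]
      by (simp add: field_simps power2_eq_square)
  qed
  \<comment> \<open>Summing over \<open>s\<close> gives
    \<open>j * (m^2 + m) + m * j * (j - 1) = (m + j) * j * m\<close>.\<close>
  also have "\<dots> = ?B ^ 2 * (?B ^ 2 - 1) / 24 * (of_nat j * (?m ^ 2 + ?m) + ?m * (2 * (\<Sum>s<j. of_nat s)))"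
    unfolding sum_distrib_left[symmetric] sum.distrib by (simp add: algebra_simps)
  also have "\<dots> = ?B ^ 2 * (of_nat ((m + j) * j * m) * (?B ^ 2 - 1) / 24)"
    unfolding sum_of_nats by (simp add: algebra_simps power2_eq_square)
  finally show "ln_coeff2 (block_expansion b \<zeta> m j) = ln_coeff2 (block_expansion b \<zeta> 0 j) +
      ?B ^ 2 * (of_nat ((m + j) * j * m) * (?B ^ 2 - 1) / 24)"
    by (simp only: diff_eq_eq add.commute)
qed

text \<open>For odd \<open>b\<close> the exponent is a multiple of \<open>b\<close>. For
  \<open>b = 2 * e\<close> it is \<open>e * (j * (b * j - 1))\<close>, where
  \<open>\<zeta> ^ e = - 1\<close> and \<open>j * (b * j - 1)\<close> has the parity of
  \<open>j\<close>.\<close>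

lemma primitive_root_power_choose_2:
  assumes "\<zeta> \<in> primitive_roots b"
  shows "\<zeta> ^ ((b * j) choose 2) = (- 1) ^ ((b - 1) * j)"
proof (cases "odd b")
  case True
  have "(b * j) choose 2 = b * (j * (b * j - 1) div 2)"
  proof -
    have "2 dvd j * (b * j - 1)" using True by (cases "j = 0") auto
    then show ?thesis by (simp only: choose_two mult.assoc div_mult_swap)
  qed
  then show ?thesis
    using True primitive_root_power_eq_1_iff[OF assms, of "(b * j) choose 2"] by simp
next
  case False
  then obtain e where e: "b = 2 * e" by (auto elim: evenE)
  have b: "b > 0" using assms by (simp add: primitive_roots_def)
  have "(\<zeta> ^ e) ^ 2 = 1" using primitive_root_power_eq_1_iff[OF assms, of b] e
    by (simp flip: power_mult add: mult.commute)
  moreover have "\<zeta> ^ e \<noteq> 1"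
    using primitive_root_power_eq_1_iff[OF assms, of e] b by (auto simp: e dest: dvd_imp_le)
  ultimately have m1: "\<zeta> ^ e = - 1" by (simp add: power2_eq_1_iff)
  have "(b * j) choose 2 = e * (j * (b * j - 1))"
    by (simp add: choose_two e mult.assoc)
  then have "\<zeta> ^ ((b * j) choose 2) = (- 1) ^ (j * (b * j - 1))"
    by (simp add: power_mult m1)
  also have "\<dots> = (- 1) ^ ((b - 1) * j)"
    using b by (intro minus_one_power_iff[THEN trans] minus_one_power_iff[THEN trans, symmetric]) (auto simp: e)
  finally show ?thesis .
qed

text \<open>\<open>A\<close> and \<open>B\<close> share the constant term \<open>(- 1) ^ j\<close>
  and the first logarithmic coefficient. \<open>B\<close> is a sign times an exponential, so its
  second one is 0, and that of \<open>A\<close> is the X^2 coefficient of \<open>C\<close> up to the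
  sign \<open>(- 1) ^ j\<close>, since (1 - exp (b X))^2 begins with b^2 X^2.\<close>

lemma block_expansion_congruence:
  fixes \<zeta> :: complex and b m j :: nat
  assumes \<zeta>: "\<zeta> \<in> primitive_roots b" and "i < 3"
  defines "A \<equiv> (- 1) ^ (b * j) * expand_qpower \<zeta> ((b * j) choose 2) *
                (block_expansion b \<zeta> m j * inverse (block_expansion b \<zeta> 0 j))"
    and "B \<equiv> (- 1) ^ ((b - 1) * (m + j) * j + j) *
                expand_qpower \<zeta> ((m + j) * (b choose 2) * j + b * (j choose 2))"
    and "C \<equiv> (1 - expand_qpower \<zeta> b) ^ 2 * ((- 1) ^ j *
                fps_const (of_nat ((m + j) * j * m) * (of_nat b ^ 2 - 1) / 24))"
  shows "(A - B - C) $ i = 0"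
proof -
  let ?B = "of_nat b :: complex" and ?l = "of_nat ((m + j) * j * m) * (of_nat b ^ 2 - 1) / 24 :: complex"
  have b: "b > 0" and \<zeta>b: "\<zeta> ^ b = 1" using \<zeta> by (simp_all add: primitive_roots_def)
  note be = block_expansion_coeffs[OF \<zeta>]
  let ?D = "block_expansion b \<zeta> 0 j"
  define K where "K = block_expansion b \<zeta> m j * inverse ?D"
  have sgn: "(- 1) ^ k = fps_const ((- 1) ^ k :: complex)" for k
    by (induction k) simp_all
  have K0: "K $ 0 = 1" using be(1,2)[of m j] be(2)[of 0 j] by (simp add: K_def)
  have KD: "block_expansion b \<zeta> m j = K * ?D"
    using be(2)[of 0 j] by (simp add: K_def mult.assoc inverse_mult_eq_1)
  have "ln_coeff1 (block_expansion b \<zeta> m j) = ln_coeff1 K + ln_coeff1 ?D"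
    and "ln_coeff2 (block_expansion b \<zeta> m j) = ln_coeff2 K + ln_coeff2 ?D"
    unfolding KD using ln_coeff_mult[of K ?D] K0 be(2)[of 0 j] by auto
  then have K1: "ln_coeff1 K = of_nat (b * m * j) * (?B - 1) / 2" and K2: "ln_coeff2 K = ?B ^ 2 * ?l"
    using be(3,4)[of m j] by (metis add.commute add_left_cancel)+
  have A_eq: "A = fps_const ((- 1) ^ (b * j) * \<zeta> ^ ((b * j) choose 2)) * fps_exp (of_nat ((b * j) choose 2)) * K"
    unfolding A_def K_def[symmetric] sgn by (simp add: mult.assoc flip: fps_const_mult)
  \<comment> \<open>The exponent \<open>(b - 1) * j + b * j\<close> is
    \<open>(2 * b - 1) * j\<close>, so the two signs combine to \<open>(- 1) ^ j\<close>.\<close>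
  have "even ((b - 1) * j + b * j) \<longleftrightarrow> even j"
    using b by (cases "even b") auto
  then have sA: "(- 1) ^ (b * j) * \<zeta> ^ ((b * j) choose 2) = (- 1) ^ j"
    using primitive_root_power_choose_2[OF \<zeta>, of j] b
    by (simp add: power_add[symmetric] minus_one_power_iff add.commute)
  have A0: "A $ 0 = (- 1) ^ j" and A1: "ln_coeff1 A = of_nat ((b * j) choose 2) + of_nat (b * m * j) * (?B - 1) / 2"
    and A2: "ln_coeff2 A = ?B ^ 2 * ?l"
  proof -
    let ?E = "fps_const ((- 1) ^ j) * fps_exp (of_nat ((b * j) choose 2) :: complex)"
    have E0: "?E $ 0 \<noteq> 0" "K $ 0 \<noteq> 0" and ne: "(- 1 :: complex) ^ j \<noteq> 0" using K0 by simp_all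
    show "ln_coeff1 A = of_nat ((b * j) choose 2) + of_nat (b * m * j) * (?B - 1) / 2"
      and "ln_coeff2 A = ?B ^ 2 * ?l"
      unfolding A_eq sA ln_coeff_mult[OF E0] K1 K2 ln_coeff_const_exp[OF ne] by (rule refl add_0)+
    show "A $ 0 = (- 1) ^ j" unfolding A_eq sA using K0 by simp
  qed
  let ?e = "(b - 1) * (m + j) * j"
  \<comment> \<open>The root of unity in \<open>B\<close> evaluates to \<open>(- 1) ^ ?e\<close> and
    cancels the explicit sign.\<close>
  have "\<zeta> ^ ((m + j) * (b choose 2) * j + b * (j choose 2)) = \<zeta> ^ ((b choose 2) * ((m + j) * j) + b * (j choose 2))"
    by (simp add: mult_ac)
  also have "\<dots> = (\<zeta> ^ (b choose 2)) ^ ((m + j) * j)"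
    by (simp only: power_add power_mult \<zeta>b power_one mult_1_right)
  also have "\<zeta> ^ (b choose 2) = (- 1) ^ (b - 1)"
    using primitive_root_power_choose_2[OF \<zeta>, of 1] by simp
  also have "((- 1) ^ (b - 1)) ^ ((m + j) * j) = (- 1 :: complex) ^ ?e"
    by (simp only: power_mult[symmetric] mult.assoc)
  finally have sB: "(- 1) ^ (?e + j) * \<zeta> ^ ((m + j) * (b choose 2) * j + b * (j choose 2)) = (- 1) ^ j"
    by (cases "even ?e") (simp_all only: power_add neg_one_even_power neg_one_odd_power, simp_all)
  have B_eq: "B = fps_const ((- 1) ^ j) * fps_exp (of_nat ((m + j) * (b choose 2) * j + b * (j choose 2)))"
    unfolding B_def sgn sB[symmetric] by (simp only: mult.assoc fps_const_mult[symmetric])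
  have B0: "B $ 0 = (- 1) ^ j" and B2: "ln_coeff2 B = 0"
    and B1: "ln_coeff1 B = of_nat ((m + j) * (b choose 2) * j + b * (j choose 2))"
    unfolding B_eq by (simp, (rule ln_coeff_const_exp, simp)+)
  have ch: "2 * of_nat (k choose 2) = of_nat k * (of_nat k - 1 :: complex)" for k
    by (induction k) (simp_all add: numeral_2_eq_2 algebra_simps)
  \<comment> \<open>This matching of first-order terms is the purpose of the factor
    \<open>q ^ (n * (b choose 2))\<close> in the second argument of \<open>qT\<close>. Doubling
    clears the halves in the binomials.\<close>
  have "2 * ln_coeff1 A = 2 * ln_coeff1 B"
  proof -
    have "2 * ln_coeff1 A = 2 * of_nat ((b * j) choose 2) + of_nat (b * m * j) * (?B - 1)"
      by (simp add: A1)
    also have "\<dots> = of_nat ((m + j) * j) * (2 * of_nat (b choose 2)) + ?B * (2 * of_nat (j choose 2))"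
      unfolding ch by (simp add: algebra_simps)
    also have "\<dots> = 2 * ln_coeff1 B"
      by (simp add: B1 algebra_simps)
    finally show ?thesis .
  qed
  then have AB1: "ln_coeff1 A = ln_coeff1 B" by simp
  have C_eq: "C = (1 - fps_exp ?B) ^ 2 * fps_const ((- 1) ^ j * ?l)"
    unfolding C_def sgn \<zeta>b by (simp add: mult.assoc flip: fps_const_mult)
  have C: "C $ 0 = 0" "C $ 1 = 0" "C $ 2 = (- 1) ^ j * (?B ^ 2 * ?l)"
    unfolding C_eq by (simp_all add: power2_eq_square[of "1 - _"] fps_mult_nth numeral_2_eq_2)
  have A0': "A $ 0 \<noteq> 0" and B0': "B $ 0 \<noteq> 0" by (simp_all add: A0 B0)
  have "A $ 1 - B $ 1 = 0"
    unfolding fps_nth_1_conv_ln_coeff[OF A0'] fps_nth_1_conv_ln_coeff[OF B0'] A0 B0 AB1 by simp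
  moreover have "A $ 2 - B $ 2 = C $ 2"
    unfolding fps_nth_2_conv_ln_coeff[OF A0'] fps_nth_2_conv_ln_coeff[OF B0'] A0 B0 AB1 A2 B2 C
    by (simp add: algebra_simps)
  moreover have "i = 0 \<or> i = 1 \<or> i = 2" using \<open>i < 3\<close> by auto
  moreover have "A $ 0 - B $ 0 = 0" by (simp add: A0 B0)
  ultimately show ?thesis using C(1,2) by auto
qed

subsection \<open>Gaussian binomial coefficients\<close>

lemma qbinom_eq_prod:
  fixes x :: "'a::field"
  assumes "x \<noteq> 1"
  shows "qbinom x (int (m + j)) (int j) = (\<Prod>i<j. 1 - x ^ (m + Suc i)) / (\<Prod>i<j. 1 - x ^ Suc i)"
proof -
  have nz: "1 - x \<noteq> 0" using assms by simp
  have "(\<Prod>i<j. qint x (int (m + j) - int i)) = (\<Prod>i<j. qint x (int (m + Suc (j - Suc i))))"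
  proof (rule prod.cong[OF refl])
    fix i assume "i \<in> {..<j}"
    then have "int (m + j) - int i = int (m + Suc (j - Suc i))" by auto
    then show "qint x (int (m + j) - int i) = qint x (int (m + Suc (j - Suc i)))" by (rule arg_cong)
  qed
  also have "\<dots> = (\<Prod>i<j. qint x (int (m + Suc i)))"
    by (rule prod.nat_diff_reindex)
  also have "\<dots> = (\<Prod>i<j. 1 - x ^ (m + Suc i)) / (1 - x) ^ j"
    by (simp only: qint_def power_int_of_nat prod_dividef prod_constant card_lessThan)
  finally have num: "(\<Prod>i<j. qint x (int (m + j) - int i)) = (\<Prod>i<j. 1 - x ^ (m + Suc i)) / (1 - x) ^ j" .
  have den: "qfact x j = (\<Prod>i<j. 1 - x ^ Suc i) / (1 - x) ^ j"
  proof -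
    have "qfact x j = (\<Prod>i<j. qint x (int (Suc i)))"
      unfolding qfact_def by (rule prod.reindex_bij_witness[where i = Suc and j = "\<lambda>i. i - 1"]) auto
    then show ?thesis by (simp only: qint_def power_int_of_nat prod_dividef prod_constant card_lessThan)
  qed
  have "qbinom x (int (m + j)) (int j) = (\<Prod>i<j. qint x (int (m + j) - int i)) / qfact x j"
    by (simp add: qbinom_def)
  also have "\<dots> = (\<Prod>i<j. 1 - x ^ (m + Suc i)) / (\<Prod>i<j. 1 - x ^ Suc i)"
    unfolding num den using nz by (simp del: power_Suc add_Suc_right)
  finally show ?thesis .
qed

text \<open>The range from 1 to \<open>b * j\<close> is cut into blocks of length \<open>b\<close>;
  the multiple \<open>b * Suc s\<close> closing each block is separated from its other
  \<open>b - 1\<close> members.\<close>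

lemma prod_blocks:
  fixes f :: "nat \<Rightarrow> 'a::comm_monoid_mult"
  assumes "b > 0"
  shows "(\<Prod>i<b * j. f (Suc i)) = (\<Prod>s<j. f (b * Suc s)) * (\<Prod>s<j. \<Prod>u\<in>{1..<b}. f (b * s + u))"
proof -
  have "(\<Prod>i<b * j. f (Suc i)) = (\<Prod>s<j. \<Prod>i\<in>{s * b..<s * b + b}. f (Suc i))"
    by (simp add: prod.nat_group mult.commute)
  also have "\<dots> = (\<Prod>s<j. f (b * Suc s) * (\<Prod>u\<in>{1..<b}. f (b * s + u)))"
  proof (rule prod.cong[OF refl])
    fix s
    have "(\<Prod>i\<in>{s * b..<s * b + b}. f (Suc i)) = (\<Prod>u\<in>{1..<Suc b}. f (b * s + u))"
      by (rule prod.reindex_bij_witness[where i = "\<lambda>u. b * s + u - 1" and j = "\<lambda>i. Suc i - b * s"])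
         (auto simp: mult.commute)
    also have "\<dots> = f (b * Suc s) * (\<Prod>u\<in>{1..<b}. f (b * s + u))"
      using assms by (simp add: atLeastLessThanSuc mult.commute add.commute)
    finally show "(\<Prod>i\<in>{s * b..<s * b + b}. f (Suc i)) = f (b * Suc s) * (\<Prod>u\<in>{1..<b}. f (b * s + u))" .
  qed
  finally show ?thesis by (simp add: prod.distrib)
qed

text \<open>The exponents divisible by \<open>b\<close> form the binomial at \<open>x ^ b\<close>.
  At a primitive \<open>b\<close>-th root those factors vanish, whereas the remaining quotient is a
  unit.\<close>

lemma qbinom_mult_split:
  fixes x :: "'a::field"
  assumes "b > 0" "\<And>k. k > 0 \<Longrightarrow> 1 - x ^ k \<noteq> 0"
  shows "qbinom x (int (b * (m + j))) (int (b * j)) = qbinom (x ^ b) (int (m + j)) (int j) *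
    ((\<Prod>s<j. \<Prod>u\<in>{1..<b}. 1 - x ^ (b * (m + s) + u)) / (\<Prod>s<j. \<Prod>u\<in>{1..<b}. 1 - x ^ (b * s + u)))"
proof -
  have ne: "x \<noteq> 1" "x ^ b \<noteq> 1" using assms(2)[of 1] assms(2)[of b] assms(1) by auto
  have e: "int (b * (m + j)) = int (b * m + b * j)" by (simp add: algebra_simps)
  have 1: "(\<Prod>i<b * j. 1 - x ^ (b * m + Suc i)) = (\<Prod>s<j. 1 - (x ^ b) ^ (m + Suc s)) *
      (\<Prod>s<j. \<Prod>u\<in>{1..<b}. 1 - x ^ (b * (m + s) + u))"
    using prod_blocks[OF assms(1), of "\<lambda>i. 1 - x ^ (b * m + i)" j]
    by (simp only: power_mult[symmetric] add_mult_distrib2 add.assoc)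
  have 2: "(\<Prod>i<b * j. 1 - x ^ Suc i) = (\<Prod>s<j. 1 - (x ^ b) ^ Suc s) *
      (\<Prod>s<j. \<Prod>u\<in>{1..<b}. 1 - x ^ (b * s + u))"
    using prod_blocks[OF assms(1), of "\<lambda>i. 1 - x ^ i" j]
    by (simp only: power_mult[symmetric])
  show ?thesis
    unfolding e qbinom_eq_prod[OF ne(1)] qbinom_eq_prod[OF ne(2)] 1 2 by simp
qed

lemma qbinom_eq_0:
  fixes x :: "'a::field"
  assumes "k < 0 \<or> int n < k"
  shows "qbinom x (int n) k = 0"
proof (cases "k < 0")
  case False
  then have "n < nat k" using assms by linarith
  moreover have "qint x (int n - int n) = 0" by (simp add: qint_def)
  ultimately have "(\<Prod>i<nat k. qint x (int n - int i)) = 0"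
    by (subst prod_zero_iff) (auto intro!: bexI[of _ n])
  then show ?thesis by (simp add: qbinom_def)
qed (simp add: qbinom_def)

subsection \<open>Values at roots of unity\<close>

text \<open>Only the constant term is kept, and it must be the same at every primitive root. This
  suffices once the modulus is \<open>\<Phi>\<^sub>b\<close> to the first power.\<close>

definition has_value :: "nat \<Rightarrow> ratfun \<Rightarrow> complex \<Rightarrow> bool" where
  "has_value b A v \<longleftrightarrow> (\<exists>F. has_expansion b A F \<and> (\<forall>\<zeta>\<in>primitive_roots b. F \<zeta> $ 0 = v))"

lemma has_valueI:
  "has_expansion b A F \<Longrightarrow> (\<And>\<zeta>. \<zeta> \<in> primitive_roots b \<Longrightarrow> F \<zeta> $ 0 = v) \<Longrightarrow> has_value b A v"
  unfolding has_value_def by blast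

lemma has_valueE:
  assumes "has_value b A v"
  obtains F where "has_expansion b A F" "\<And>\<zeta>. \<zeta> \<in> primitive_roots b \<Longrightarrow> F \<zeta> $ 0 = v"
  using assms unfolding has_value_def by blast

lemma has_value_mult:
  assumes "has_value b A v" "has_value b B w"
  shows "has_value b (A * B) (v * w)"
  by (rule has_valueE[OF assms(1)], rule has_valueE[OF assms(2)],
      rule has_valueI[OF has_expansion_mult]) auto

lemma has_value_diff:
  assumes "has_value b A v" "has_value b B w" "b > 0"
  shows "has_value b (A - B) (v - w)"
  by (rule has_valueE[OF assms(1)], rule has_valueE[OF assms(2)],
      rule has_valueI[OF has_expansion_diff[OF _ _ assms(3)]]) auto

lemma has_value_uminus: "has_value b A v \<Longrightarrow> has_value b (- A) (- v)"
  by (erule has_valueE, rule has_valueI[OF has_expansion_uminus]) auto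

lemma has_value_inverse:
  assumes "has_value b A v" "v \<noteq> 0"
  shows "has_value b (inverse A) (inverse v)"
  by (rule has_valueE[OF assms(1)], rule has_valueI[OF has_expansion_inverse]) (auto simp: assms(2))

lemma has_value_divide:
  assumes "has_value b A v" "has_value b B w" "w \<noteq> 0"
  shows "has_value b (A / B) (v / w)"
  unfolding divide_inverse by (intro has_value_mult has_value_inverse assms)

lemma has_value_of_nat: "has_value b (of_nat k) (of_nat k)"
  by (rule has_valueI[OF has_expansion_of_nat]) simp

lemma has_value_1: "has_value b 1 1"
  using has_value_of_nat[of b 1] by simp

lemma has_value_prod:
  assumes "\<And>i. i \<in> S \<Longrightarrow> has_value b (f i) (v i)"
  shows "has_value b (prod f S) (prod v S)"
  using assms
  by (induction S rule: infinite_finite_induct) (auto intro: has_value_mult has_value_1)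

lemma has_value_power: "has_value b A v \<Longrightarrow> has_value b (A ^ k) (v ^ k)"
  using has_value_prod[of "{..<k}" b "\<lambda>_. A" "\<lambda>_. v"] by simp

lemma has_value_qpower: "b dvd k \<Longrightarrow> has_value b (qvar ^ k) 1"
  by (rule has_valueI[OF has_expansion_qpower]) (simp add: primitive_root_power_eq_1_iff)

lemma has_value_imp_integral: "has_value b A v \<Longrightarrow> A \<in> cyclotomic_ideal b 0"
  by (elim has_valueE has_expansion_imp_integral)

lemma has_value_0_imp_cyclotomic_ideal: "has_value b A 0 \<Longrightarrow> A \<in> cyclotomic_ideal b 1"
  by (erule has_valueE, erule has_expansion_imp_cyclotomic_ideal) simp

lemma has_value_qint_nat:
  assumes "b dvd k" "k > 0" "b > 0"
  shows "has_value b (qint (qvar ^ k) (int n)) (of_nat n)"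
proof -
  have "qint (qvar ^ k) (int n) = (\<Sum>i<n. qvar ^ (k * i))"
    using qvar_power_neq_1[OF assms(2)] one_diff_power_eq[of "qvar ^ k" n]
    by (simp add: qint_def power_mult)
  moreover have "has_expansion b (\<Sum>i<n. qvar ^ (k * i)) (\<lambda>\<zeta>. \<Sum>i<n. expand_qpower \<zeta> (k * i))"
    using assms(3) by (intro has_expansion_sum has_expansion_qpower)
  then have "has_value b (\<Sum>i<n. qvar ^ (k * i)) (of_nat n)"
  proof (rule has_valueI)
    fix \<zeta> assume "\<zeta> \<in> primitive_roots b"
    then have "\<zeta> ^ (k * i) = 1" for i using assms(1) by (simp add: primitive_root_power_eq_1_iff)
    then show "(\<Sum>i<n. expand_qpower \<zeta> (k * i)) $ 0 = of_nat n" by (simp add: fps_sum_nth)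
  qed
  ultimately show ?thesis by simp
qed

text \<open>For negative integers, \<open>[- n] = - q ^ (- n) * [n]\<close> in base
  \<open>q\<close>; with \<open>b dvd k\<close>, the power of \<open>qvar ^ k\<close> has value
  1.\<close>

lemma has_value_qint:
  assumes "b dvd k" "k > 0" "b > 0"
  shows "has_value b (qint (qvar ^ k) t) (of_int t)"
proof (cases t rule: int_cases2)
  case (nonneg n)
  then show ?thesis using has_value_qint_nat[OF assms] by simp
next
  case (nonpos n)
  have "qint (qvar ^ k) t = - (inverse (qvar ^ (k * n)) * qint (qvar ^ k) (int n))"
    using qvar_power_neq_1[OF assms(2)]
    by (simp add: nonpos qint_def power_int_minus power_mult field_simps)
  moreover have "has_value b (- (inverse (qvar ^ (k * n)) * qint (qvar ^ k) (int n))) (- (inverse 1 * of_nat n))"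
    using assms(1)
    by (intro has_value_uminus has_value_mult has_value_inverse has_value_qint_nat[OF assms] has_value_qpower) auto
  ultimately show ?thesis by (simp add: nonpos)
qed

lemma has_value_qfact:
  assumes "b dvd k" "k > 0" "b > 0"
  shows "has_value b (qfact (qvar ^ k) n) (fact n)"
proof -
  have "has_value b (qfact (qvar ^ k) n) (\<Prod>i=1..n. of_int (int i))"
    unfolding qfact_def by (intro has_value_prod has_value_qint assms)
  then show ?thesis by (simp add: fact_prod)
qed

text \<open>The upper argument \<open>t\<close> may be negative, as \<open>(k - r) / c\<close> can
  be; hence the generalized binomial on the right.\<close>

lemma has_value_qbinom:
  assumes "b dvd k" "k > 0" "b > 0"
  shows "has_value b (qbinom (qvar ^ k) t (int l)) (of_int t gchoose l)"
proof -
  have "qbinom (qvar ^ k) t (int l) = (\<Prod>i<l. qint (qvar ^ k) (t - int i)) / qfact (qvar ^ k) l"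
    by (simp add: qbinom_def)
  moreover have "has_value b \<dots> ((\<Prod>i<l. of_int (t - int i)) / fact l)"
    by (intro has_value_divide has_value_prod has_value_qint has_value_qfact assms fact_nonzero)
  moreover have "(\<Prod>i<l. of_int (t - int i)) / fact l = (of_int t gchoose l :: complex)"
    by (simp add: gbinomial_prod_rev lessThan_atLeast0)
  ultimately show ?thesis by simp
qed

subsection \<open>Comparison of the sums\<close>

text \<open>This compares the sums term by term. The binomial at \<open>q ^ b\<close> is common to
  all three terms and integral; what remains is a statement about the quotient of blocks, settled by
  \<open>block_expansion_congruence\<close>.\<close>

lemma qbinom_mult_congruence:
  fixes b m j :: nat
  assumes b: "b > 0"
  defines "n \<equiv> m + j"
  shows "(- 1) ^ (b * j) * qvar ^ ((b * j) choose 2) * qbinom qvar (int (b * n)) (int (b * j))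
      - (- 1) ^ ((b - 1) * n * j) * ((- 1) ^ j * (qvar ^ (n * (b choose 2))) ^ j *
          (qvar ^ b) ^ (j choose 2) * qbinom (qvar ^ b) (int n) (int j))
      - (1 - qvar ^ b) ^ 2 * ((- 1) ^ j * (of_nat (n * j * m * (b ^ 2 - 1)) / of_nat 24) *
          qbinom (qvar ^ b) (int n) (int j))
    \<in> cyclotomic_ideal b 3" (is "?X - ?Y - ?Z \<in> _")
proof -
  let ?Q = "qbinom (qvar ^ b) (int n) (int j)"
  \<comment> \<open>The denominator is written with \<open>0 + s\<close> so that it is the block
    product for \<open>m = 0\<close>.\<close>
  define K where "K = (\<Prod>s<j. \<Prod>u\<in>{1..<b}. 1 - qvar ^ (b * (m + s) + u)) *
      inverse (\<Prod>s<j. \<Prod>u\<in>{1..<b}. 1 - qvar ^ (b * (0 + s) + u))"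
  define A where "A = (- 1) ^ (b * j) * qvar ^ ((b * j) choose 2) * K"
  define B where "B = (- 1) ^ ((b - 1) * n * j + j) * qvar ^ (n * (b choose 2) * j + b * (j choose 2))"
  define C where "C = (1 - qvar ^ b) ^ 2 * ((- 1) ^ j * (of_nat (n * j * m * (b ^ 2 - 1)) * inverse (of_nat 24)))"
  have "qbinom qvar (int (b * n)) (int (b * j)) = ?Q * K"
    unfolding n_def K_def by (simp only: qbinom_mult_split[OF b qvar_power_neq_1] divide_inverse add_0)
  then have eq: "?X - ?Y - ?Z = ?Q * (A - B - C)"
  proof -
    assume K: "qbinom qvar (int (b * n)) (int (b * j)) = ?Q * K"
    have e: "qvar ^ (n * (b choose 2) * j + b * (j choose 2)) =
        (qvar ^ (n * (b choose 2))) ^ j * (qvar ^ b) ^ (j choose 2)"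
      by (simp only: power_add power_mult)
    have "?X = ?Q * A" unfolding A_def K by (simp only: mult_ac)
    moreover have "?Y = ?Q * B"
      unfolding B_def e power_add[of "- 1"] by (simp only: mult_ac)
    moreover have "?Z = ?Q * C" unfolding C_def divide_inverse by (simp only: mult_ac)
    ultimately show ?thesis by (simp only: right_diff_distrib)
  qed
  have neg: "has_expansion b ((- 1) ^ k) (\<lambda>\<zeta>. (- 1) ^ k)" for k
    by (intro has_expansion_power has_expansion_uminus has_expansion_1)
  have blocks: "has_expansion b (\<Prod>s<j. \<Prod>u\<in>{1..<b}. 1 - qvar ^ (b * (m + s) + u))
      (\<lambda>\<zeta>. block_expansion b \<zeta> m j)" for m
    unfolding block_expansion_def
    by (intro has_expansion_prod has_expansion_diff has_expansion_1 has_expansion_qpower b)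
  have "has_expansion b K (\<lambda>\<zeta>. block_expansion b \<zeta> m j * inverse (block_expansion b \<zeta> 0 j))"
    unfolding K_def
    by (rule has_expansion_mult[OF blocks has_expansion_inverse[OF blocks block_expansion_coeffs(2)]])
  then have A: "has_expansion b A (\<lambda>\<zeta>. (- 1) ^ (b * j) * expand_qpower \<zeta> ((b * j) choose 2) *
        (block_expansion b \<zeta> m j * inverse (block_expansion b \<zeta> 0 j)))"
    unfolding A_def by (rule has_expansion_mult[OF has_expansion_mult[OF neg has_expansion_qpower]])
  have B: "has_expansion b B (\<lambda>\<zeta>. (- 1) ^ ((b - 1) * n * j + j) *
        expand_qpower \<zeta> (n * (b choose 2) * j + b * (j choose 2)))"
    unfolding B_def by (rule has_expansion_mult[OF neg has_expansion_qpower])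
  have "has_expansion b (inverse (of_nat 24)) (\<lambda>_. inverse (of_nat 24))"
    by (rule has_expansion_inverse[OF has_expansion_of_nat]) simp
  then have C: "has_expansion b C (\<lambda>\<zeta>. (1 - expand_qpower \<zeta> b) ^ 2 *
        ((- 1) ^ j * (of_nat (n * j * m * (b ^ 2 - 1)) * inverse (of_nat 24))))"
    unfolding C_def
    by (rule has_expansion_mult[OF has_expansion_power[OF has_expansion_diff[OF has_expansion_1 has_expansion_qpower b]]
          has_expansion_mult[OF neg has_expansion_mult[OF has_expansion_of_nat]]])
  note has_expansion_diff[OF has_expansion_diff[OF A B b] C b]
  moreover have "(of_nat (n * j * m * (b ^ 2 - 1)) * inverse (of_nat 24) :: complex fps) =
      fps_const (of_nat ((m + j) * j * m) * (of_nat b ^ 2 - 1) / 24)"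
    unfolding fps_of_nat[symmetric] fps_const_inverse fps_const_mult
    using b by (simp add: n_def of_nat_diff)
  ultimately have "A - B - C \<in> cyclotomic_ideal b 3"
    using block_expansion_congruence[of _ b _ j m]
    by (elim has_expansion_imp_cyclotomic_ideal) (simp only: n_def)
  then show ?thesis
    unfolding eq
    by (rule cyclotomic_ideal_mult_left[OF has_value_imp_integral[OF has_value_qbinom[OF dvd_refl b b]]])
qed

section \<open>The T's as finite sums\<close>

lemma qT_eq_sum:
  fixes q z :: "'a::field"
  shows "qT b c l n r q z =
    qfact (q ^ c) l * cyclotomic_at c q ^ l / qfact (q ^ (c div b)) (n * b div c) *
    (\<Sum>j\<le>n. if [int j = r] (mod int c)
      then (- 1) ^ j * z ^ j * q ^ (j choose 2) * qbinom q (int n) (int j) *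
        qbinom (q ^ c) ((int j - r) div int c) (int l) else 0)"
proof -
  let ?f = "\<lambda>k::int. if [k = r] (mod int c)
       then (- 1) powi k * z powi k * q powi (k * (k - 1) div 2) *
            qbinom q (int n) k * qbinom (q ^ c) ((k - r) div int c) (int l)
       else 0"
  have sub: "{k. ?f k \<noteq> 0} \<subseteq> int ` {..n}"
  proof
    fix k assume "k \<in> {k. ?f k \<noteq> 0}"
    then have "qbinom q (int n) k \<noteq> 0" by (auto split: if_splits)
    then have "0 \<le> k" "k \<le> int n" using qbinom_eq_0[of k n q] by linarith+
    then show "k \<in> int ` {..n}" by (intro image_eqI[of _ _ "nat k"]) auto
  qed
  have tri: "int j * (int j - 1) div 2 = int (j choose 2)" for j
    by (cases j) (simp_all add: choose_two zdiv_int algebra_simps)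
  have "Sum_any ?f = sum ?f (int ` {..n})"
    by (rule Sum_any.expand_superset) (simp_all add: sub)
  also have "\<dots> = (\<Sum>j\<le>n. ?f (int j))"
    by (simp add: sum.reindex)
  finally show ?thesis
    unfolding qT_def by (simp only: tri power_int_of_nat)
qed

text \<open>A summation index congruent to \<open>b * r\<close> modulo \<open>b * c\<close> is a
  multiple of \<open>b\<close>, say \<open>b * j\<close>; the congruence and the quotient by the
  modulus can then be divided by \<open>b\<close>.\<close>

lemma qT_mult_eq_sum:
  fixes q z :: "'a::field"
  assumes "b > 0" "c > 0"
  shows "qT b (b * c) l (b * n) (int (b * r)) q z =
    qfact (q ^ (b * c)) l * cyclotomic_at (b * c) q ^ l / qfact (q ^ c) (n * b div c) *
    (\<Sum>j\<le>n. if [int j = int r] (mod int c)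
      then (- 1) ^ (b * j) * z ^ (b * j) * q ^ ((b * j) choose 2) * qbinom q (int (b * n)) (int (b * j)) *
        qbinom (q ^ (b * c)) ((int j - int r) div int c) (int l) else 0)"
proof -
  let ?f = "\<lambda>k::nat. if [int k = int (b * r)] (mod int (b * c))
      then (- 1) ^ k * z ^ k * q ^ (k choose 2) * qbinom q (int (b * n)) (int k) *
        qbinom (q ^ (b * c)) ((int k - int (b * r)) div int (b * c)) (int l) else 0"
  have "sum ?f {..b * n} = sum ?f ((*) b ` {..n})"
  proof (rule sum.mono_neutral_right)
    show "\<forall>k\<in>{..b * n} - (*) b ` {..n}. ?f k = 0"
    proof
      fix k assume k: "k \<in> {..b * n} - (*) b ` {..n}"
      have "\<not> [int k = int (b * r)] (mod int (b * c))"
      proof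
        assume "[int k = int (b * r)] (mod int (b * c))"
        then have "[int k = int (b * r)] (mod int b)"
          by (rule cong_dvd_modulus) simp
        then have "int b dvd int k \<longleftrightarrow> int b dvd int (b * r)"
          by (rule cong_dvd_iff)
        then have "b dvd k" by (simp only: of_nat_dvd_iff dvd_triv_left)
        then show False using k assms(1) by (auto elim!: dvdE)
      qed
      then show "?f k = 0" by simp
    qed
  qed (use assms in auto)
  also have "\<dots> = (\<Sum>j\<le>n. ?f (b * j))"
    using assms(1) by (subst sum.reindex) (auto simp: inj_on_def)
  also have "\<dots> = (\<Sum>j\<le>n. if [int j = int r] (mod int c)
      then (- 1) ^ (b * j) * z ^ (b * j) * q ^ ((b * j) choose 2) * qbinom q (int (b * n)) (int (b * j)) *
        qbinom (q ^ (b * c)) ((int j - int r) div int c) (int l) else 0)"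
  proof (rule sum.cong[OF refl])
    fix j
    have "[int (b * j) = int (b * r)] (mod int (b * c)) \<longleftrightarrow> [int j = int r] (mod int c)"
      using assms(1) by (simp add: cong_int_iff cong_def mult_mod_right[symmetric])
    moreover have "(int (b * j) - int (b * r)) div int (b * c) = (int j - int r) div int c"
      using assms(1) by (simp flip: right_diff_distrib)
    ultimately show "?f (b * j) = (if [int j = int r] (mod int c)
      then (- 1) ^ (b * j) * z ^ (b * j) * q ^ ((b * j) choose 2) * qbinom q (int (b * n)) (int (b * j)) *
        qbinom (q ^ (b * c)) ((int j - int r) div int c) (int l) else 0)"
      by (simp only:)
  qed
  finally show ?thesis
    unfolding qT_eq_sum using assms by (simp add: mult.assoc)
qed

text \<open>All three sums are indexed by the same \<open>j\<close> with common factors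
  \<open>W\<close>, \<open>G j\<close> and \<open>zvar ^ (b * j)\<close>. It remains to show for
  each \<open>j\<close> that the other factors, functions of \<open>q\<close> alone, cancel modulo
  \<open>\<Phi>\<^sub>b\<close>.\<close>

lemma qT_difference_in_cyclotomic_ideal:
  fixes b c l n r :: nat
  assumes b: "b > 0" and c: "c > 0" and "b dvd c" and n: "n \<ge> 2"
  shows "1 / (1 - qvar ^ b) ^ 2 *
         (qT b (b * c) l (b * n) (int (b * r)) qvar zvar
          - (- 1) ^ ((b - 1) * n * r) *
            qT b c l n (int r) (qvar ^ b) (zvar ^ b * qvar ^ (n * (b choose 2))))
       - (- (of_nat (fact ((n - 2) * b div c)) / of_nat (fact (n * b div c))
           * (of_nat ((b ^ 2 - 1) * n ^ 2 * (n - 1)) / 24)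
           * zvar ^ b * qT b c l (n - 2) (int r - 1) (qvar ^ b) (zvar ^ b)))
    \<in> cyclotomic_ideal b 1"
proof -
  define M M' where "M = n * b div c" and "M' = (n - 2) * b div c"
  define W where "W = qfact (qvar ^ (b * c)) l * cyclotomic_at (b * c) qvar ^ l"
  define N N' where "N = qfact (qvar ^ c) M" and "N' = qfact (qvar ^ c) M'"
  define G where "G = (\<lambda>j. qbinom (qvar ^ (b * c)) ((int j - int r) div int c) (int l))"
  define P where "P = (\<lambda>j. [int j = int r] (mod int c))"
  define X where "X = (\<lambda>j. (- 1) ^ (b * j) * qvar ^ ((b * j) choose 2) * qbinom qvar (int (b * n)) (int (b * j)))"
  define Y where "Y = (\<lambda>j. (- 1) ^ ((b - 1) * n * j) * ((- 1) ^ j * (qvar ^ (n * (b choose 2))) ^ j *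
          (qvar ^ b) ^ (j choose 2) * qbinom (qvar ^ b) (int n) (int j)))"
  define Z where "Z = (\<lambda>i. (- 1) ^ i * (qvar ^ b) ^ (i choose 2) * qbinom (qvar ^ b) (int (n - 2)) (int i))"
  define k :: ratfun where "k = of_nat (fact M') / of_nat (fact M) * (of_nat ((b ^ 2 - 1) * n ^ 2 * (n - 1)) / 24)"
  \<comment> \<open>The coefficient of the third sum after the shift \<open>i = j - 1\<close>; as
    \<open>i\<close> runs from 0 to \<open>n - 2\<close>, there is none for \<open>j = 0\<close> and
    \<open>j = n\<close>.\<close>
  define H where "H = (\<lambda>j. if 0 < j \<and> j < n then k / N' * Z (j - 1) else 0)"
  define D where "D = 1 - qvar ^ b"
  have cyc: "cyclotomic_at c (qvar ^ b) = cyclotomic_at (b * c) qvar"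
    by (rule cyclotomic_at_mult_dvd[OF \<open>b dvd c\<close> b c, symmetric])
  have qbc: "(qvar ^ b) ^ (c div b) = qvar ^ c" "(qvar ^ b) ^ c = qvar ^ (b * c)"
    using \<open>b dvd c\<close> by (simp_all flip: power_mult)

  have T1: "qT b (b * c) l (b * n) (int (b * r)) qvar zvar =
      W / N * (\<Sum>j\<le>n. if P j then zvar ^ (b * j) * X j * G j else 0)"
    unfolding qT_mult_eq_sum[OF b c] W_def N_def M_def P_def X_def G_def
    by (intro arg_cong2[where f = "(*)"] sum.cong refl) (simp add: mult_ac)
  have T2: "(- 1) ^ ((b - 1) * n * r) *
      qT b c l n (int r) (qvar ^ b) (zvar ^ b * qvar ^ (n * (b choose 2))) =
      W / N * (\<Sum>j\<le>n. if P j then zvar ^ (b * j) * Y j * G j else 0)"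
  proof -
    \<comment> \<open>The sign moves inside the sum: for odd \<open>b\<close> it is 1, and for even
      \<open>b\<close> also \<open>c\<close> is even, so \<open>j\<close> and \<open>r\<close> have
      the same parity.\<close>
    have sgn: "(- 1 :: ratfun) ^ ((b - 1) * n * r) = (- 1) ^ ((b - 1) * n * j)" if "P j" for j
    proof (cases "even b")
      case True
      then have "2 dvd c" using \<open>b dvd c\<close> dvd_trans by blast
      then have "[j = r] (mod 2)"
        using that cong_dvd_modulus_nat by (auto simp: P_def cong_int_iff)
      then have "even j \<longleftrightarrow> even r" by (rule cong_dvd_iff)
      then show ?thesis by (simp add: minus_one_power_iff)
    qed (simp add: minus_one_power_iff)
    have t: "qT b c l n (int r) (qvar ^ b) (zvar ^ b * qvar ^ (n * (b choose 2))) =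
      W / N * (\<Sum>j\<le>n. if P j then (- 1) ^ j * (zvar ^ b * qvar ^ (n * (b choose 2))) ^ j *
        (qvar ^ b) ^ (j choose 2) * qbinom (qvar ^ b) (int n) (int j) * G j else 0)"
      unfolding qT_eq_sum cyc qbc W_def N_def M_def P_def G_def by (rule refl)
    show ?thesis
      unfolding t mult.left_commute[of "(- 1) ^ ((b - 1) * n * r)" "W / N"] sum_distrib_left
    proof (rule sum.cong[OF refl])
      fix j
      show "W / N * ((- 1) ^ ((b - 1) * n * r) * (if P j then (- 1) ^ j * (zvar ^ b * qvar ^ (n * (b choose 2))) ^ j *
          (qvar ^ b) ^ (j choose 2) * qbinom (qvar ^ b) (int n) (int j) * G j else 0)) =
        W / N * (if P j then zvar ^ (b * j) * Y j * G j else 0)"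
      proof (cases "P j")
        case True
        then show ?thesis
          unfolding if_P[OF True] sgn[OF True] Y_def power_mult_distrib power_mult[of zvar b j]
          by (simp only: mult_ac)
      qed simp
    qed
  qed
  have T3: "qT b c l (n - 2) (int r - 1) (qvar ^ b) (zvar ^ b) =
      W / N' * (\<Sum>i\<le>n - 2. if P (Suc i) then zvar ^ (b * i) * Z i * G (Suc i) else 0)"
  proof -
    have "[int i = int r - 1] (mod int c) \<longleftrightarrow> P (Suc i)" for i
      using cong_add_rcancel[of "int i" 1 "int r - 1" "int c"] by (simp add: P_def add.commute)
    moreover have "int i - (int r - 1) = int (Suc i) - int r" for i by simp
    ultimately show ?thesis
      unfolding qT_eq_sum cyc qbc W_def M'_def N'_def Z_def G_def power_mult[of zvar b]
      by (simp only: mult_ac)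
  qed
  have "k * zvar ^ b * qT b c l (n - 2) (int r - 1) (qvar ^ b) (zvar ^ b) =
      W * (\<Sum>i\<le>n - 2. if P (Suc i) then zvar ^ (b * Suc i) * G (Suc i) * H (Suc i) else 0)"
    unfolding T3 sum_distrib_left
    by (intro sum.cong refl) (use n in \<open>auto simp: H_def power_add mult_ac\<close>)
  also have "(\<Sum>i\<le>n - 2. if P (Suc i) then zvar ^ (b * Suc i) * G (Suc i) * H (Suc i) else 0) =
      (\<Sum>j\<in>{1..n - 1}. if P j then zvar ^ (b * j) * G j * H j else 0)"
    by (rule sum.reindex_bij_witness[where i = "\<lambda>j. j - 1" and j = Suc]) (use n in auto)
  also have "\<dots> = (\<Sum>j\<le>n. if P j then zvar ^ (b * j) * G j * H j else 0)"
    by (rule sum.mono_neutral_left) (auto simp: H_def)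
  finally have T3': "k * zvar ^ b * qT b c l (n - 2) (int r - 1) (qvar ^ b) (zvar ^ b) =
      W * (\<Sum>j\<le>n. if P j then zvar ^ (b * j) * G j * H j else 0)" .
  have "1 / D ^ 2 * (W / N * (\<Sum>j\<le>n. if P j then zvar ^ (b * j) * X j * G j else 0)
        - W / N * (\<Sum>j\<le>n. if P j then zvar ^ (b * j) * Y j * G j else 0))
      - - (W * (\<Sum>j\<le>n. if P j then zvar ^ (b * j) * G j * H j else 0)) =
    W * (\<Sum>j\<le>n. if P j then zvar ^ (b * j) * G j * ((X j - Y j) / D ^ 2 / N + H j) else 0)"
    unfolding sum_distrib_left right_diff_distrib[symmetric] sum_subtractf[symmetric] diff_minus_eq_add sum.distrib[symmetric]
    by (intro sum.cong refl) (simp add: divide_inverse algebra_simps)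
  also have "\<dots> \<in> cyclotomic_ideal b 1"
  proof (intro cyclotomic_ideal_mult_left cyclotomic_ideal_sum b)
    show "W \<in> cyclotomic_ideal b 0"
    proof -
      have "cyclotomic_at (b * c) qvar \<in> cyclotomic_ideal b 0"
        unfolding cyclotomic_at_qvar of_qpoly_def by (rule to_fract_in_cyclotomic_ideal)
      then have "cyclotomic_at (b * c) qvar ^ l \<in> cyclotomic_ideal b 0"
        using has_value_imp_integral[OF has_value_1]
        by (induction l) (auto intro: cyclotomic_ideal_mult_left)
      moreover have "qfact (qvar ^ (b * c)) l \<in> cyclotomic_ideal b 0"
        by (rule has_value_imp_integral[OF has_value_qfact]) (use b c in auto)
      ultimately show ?thesis unfolding W_def by (intro cyclotomic_ideal_mult_left)
    qed
    fix j assume "j \<in> {..n}"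
    then have j: "j \<le> n" by simp
    have N: "has_value b N (fact M)" and N': "has_value b N' (fact M')"
      unfolding N_def N'_def using \<open>b dvd c\<close> b c by (auto intro!: has_value_qfact)
    have neg: "has_value b ((- 1) ^ e) ((- 1) ^ e)" for e
      by (intro has_value_power has_value_uminus has_value_1)
    have qb: "has_value b (qbinom (qvar ^ b) (int a) (int e)) (of_nat (a choose e))" for a e
      using has_value_qbinom[of b b "int a" e] b by (simp add: binomial_gbinomial)
    \<comment> \<open>\<open>Q\<close> is the quadratic correction of
      \<open>qbinom_mult_congruence\<close> for \<open>m = n - j\<close>, and \<open>q\<close> is
      the value of \<open>Q / N\<close> at the primitive roots.\<close>
    define Q where "Q = (- 1) ^ j * (of_nat (n * j * (n - j) * (b ^ 2 - 1)) / of_nat 24) * qbinom (qvar ^ b) (int n) (int j)"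
    define q where "q = (- 1) ^ j * (of_nat (n * j * (n - j) * (b ^ 2 - 1)) / of_nat 24) * of_nat (n choose j) / (fact M :: complex)"
    have Qv: "has_value b (Q / N) q"
      unfolding Q_def q_def
      by (intro has_value_divide has_value_mult has_value_of_nat neg qb N) auto
    have Hv: "has_value b (H j) (- q)"
    proof (cases "0 < j \<and> j < n")
      case True
      obtain i where i: "j = Suc i" using True by (cases j) auto
      have k24: "k = of_nat (fact M') / of_nat (fact M) * (of_nat ((b ^ 2 - 1) * n ^ 2 * (n - 1)) / of_nat 24)"
        by (simp only: k_def of_nat_numeral)
      have val: "has_value b (k / N' * Z i)
         (of_nat (fact M') / of_nat (fact M) * (of_nat ((b ^ 2 - 1) * n ^ 2 * (n - 1)) / of_nat 24) / fact M' *
           ((- 1) ^ i * 1 ^ (i choose 2) * of_nat ((n - 2) choose i)))"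
        unfolding k24 Z_def
        by (intro has_value_divide has_value_mult has_value_of_nat has_value_power[OF has_value_qpower[OF dvd_refl]]
            neg qb N') auto
      \<comment> \<open>Absorbing \<open>n - j\<close> and then \<open>j\<close> lowers the binomial
        to \<open>n - 2\<close>; this is the origin of \<open>n - 2\<close> and \<open>r - 1\<close>
        on the right-hand side.\<close>
      have binom: "n * j * (n - j) * (n choose j) = n ^ 2 * (n - 1) * ((n - 2) choose i)"
      proof -
        have "(n - j) * (n choose j) = n * ((n - 1) choose j)"
          using binomial_absorb_comp[of n j] by simp
        moreover have "j * ((n - 1) choose j) = (n - 1) * ((n - 2) choose i)"
          using times_binomial_minus1_eq[of j "n - 1"] by (simp add: i numeral_2_eq_2)
        ultimately show ?thesis by (simp add: power2_eq_square mult_ac)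
      qed
      have "n * j * (n - j) * (b ^ 2 - 1) * (n choose j) = (b ^ 2 - 1) * (n * j * (n - j) * (n choose j))"
        by (simp only: mult_ac)
      also have "\<dots> = (b ^ 2 - 1) * n ^ 2 * (n - 1) * ((n - 2) choose i)"
        unfolding binom by (simp only: mult_ac)
      finally have eq: "n * j * (n - j) * (b ^ 2 - 1) * (n choose j) = (b ^ 2 - 1) * n ^ 2 * (n - 1) * ((n - 2) choose i)" .
      define s t u v :: complex where "s = of_nat (n * j * (n - j) * (b ^ 2 - 1))"
        and "t = of_nat ((b ^ 2 - 1) * n ^ 2 * (n - 1))"
        and "u = of_nat (n choose j)" and "v = of_nat ((n - 2) choose i)"
      have su: "s * u = t * v"
        unfolding s_def t_def u_def v_def of_nat_mult[symmetric] eq ..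
      \<comment> \<open>As \<open>j = i + 1\<close>, the minus sign turns \<open>(- 1) ^ j\<close>
        into \<open>(- 1) ^ i\<close>. The factorial of \<open>M'\<close> in \<open>k\<close> then
        cancels the value of \<open>N'\<close>.\<close>
      have "- q = (- 1) ^ i * (s * u) / (24 * fact M)"
        unfolding q_def s_def[symmetric] u_def[symmetric] by (simp add: i)
      then have "of_nat (fact M') / of_nat (fact M) * (t / of_nat 24) / fact M' * ((- 1) ^ i * 1 ^ (i choose 2) * v) = - q"
        unfolding su by (simp add: mult_ac)
      then show ?thesis
        using True val unfolding t_def[symmetric] v_def[symmetric] by (simp add: H_def i)
    next
      case False
      \<comment> \<open>Here \<open>q = 0\<close> because of its factor
        \<open>j * (n - j)\<close>.\<close>
      then have "j = 0 \<or> j = n" using j by auto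
      then show ?thesis
        using False has_value_of_nat[of b 0] by (auto simp: H_def q_def)
    qed
    \<comment> \<open>The error \<open>E\<close> is a multiple of \<open>\<Phi>\<^sub>b ^ 3\<close>,
      so one factor survives the division by \<open>D ^ 2\<close>.\<close>
    define E where "E = X j - Y j - D ^ 2 * Q"
    have E: "E \<in> cyclotomic_ideal b (1 + 2)"
      using qbinom_mult_congruence[OF b, of j "n - j"]
      unfolding E_def X_def Y_def D_def Q_def le_add_diff_inverse2[OF j] by (simp only: one_plus_numeral) simp
    have "inverse N \<in> cyclotomic_ideal b 0"
      by (rule has_value_imp_integral[OF has_value_inverse[OF N]]) simp
    then have "inverse N * (E / D ^ 2) \<in> cyclotomic_ideal b 1"
      using divide_one_minus_qpower[OF E b] by (intro cyclotomic_ideal_mult_left) (simp_all add: D_def)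
    moreover have "Q / N + H j \<in> cyclotomic_ideal b 1"
      using has_value_diff[OF Qv has_value_uminus[OF Hv] b]
      by (intro has_value_0_imp_cyclotomic_ideal) simp
    moreover have "(X j - Y j) / D ^ 2 / N + H j = inverse N * (E / D ^ 2) + (Q / N + H j)"
    proof -
      have "D \<noteq> 0" using qvar_power_neq_1[OF b] by (simp add: D_def)
      moreover have "X j - Y j = E + D ^ 2 * Q" by (simp add: E_def)
      ultimately show ?thesis
        by (simp only: add_divide_distrib) (simp add: divide_inverse[of _ N] mult_ac)
    qed
    ultimately have "(X j - Y j) / D ^ 2 / N + H j \<in> cyclotomic_ideal b 1"
      using b by (simp only: cyclotomic_ideal_add)
    moreover have "G j \<in> cyclotomic_ideal b 0"
      unfolding G_def by (rule has_value_imp_integral[OF has_value_qbinom]) (use b c in auto)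
    ultimately show "(if P j then zvar ^ (b * j) * G j * ((X j - Y j) / D ^ 2 / N + H j) else 0)
        \<in> cyclotomic_ideal b 1"
      by (auto intro!: cyclotomic_ideal_mult_left zvar_power_in_cyclotomic_ideal)
  qed
  finally show ?thesis
    unfolding T1 T2 T3'[symmetric] k_def M_def M'_def D_def .
qed

theorem theorem3p2:
  fixes b c l n r :: nat
  assumes "b \<ge> 2" and "c \<ge> 2" and "b dvd c" and "n \<ge> 2"
  shows
    "cong_cyclotomic b 1
       (1 / (1 - qvar ^ b) ^ 2 *
         (qT b (b * c) l (b * n) (int (b * r)) qvar zvar
          - (- 1) ^ ((b - 1) * n * r) *
            qT b c l n (int r) (qvar ^ b) (zvar ^ b * qvar ^ (n * (b choose 2)))))
       (- (of_nat (fact ((n - 2) * b div c)) / of_nat (fact (n * b div c))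
           * (of_nat ((b ^ 2 - 1) * n ^ 2 * (n - 1)) / 24)
           * zvar ^ b * qT b c l (n - 2) (int r - 1) (qvar ^ b) (zvar ^ b)))
     \<and>
     cong_cyclotomic b 3
       (qT b (b ^ 2) l (b * n) (int (b * r)) qvar zvar
        - (- 1) ^ ((b - 1) * n * r) *
          qT b b l n (int r) (qvar ^ b) (zvar ^ b * qvar ^ (n * (b choose 2))))
       (- (of_nat ((b ^ 2 - 1) * n) / 24
           * zvar ^ b * (1 - qvar ^ b) ^ 2 * qT b b l (n - 2) (int r - 1) (qvar ^ b) (zvar ^ b)))"
proof (intro conjI cong_cyclotomicI)
  show "b > 0" "b > 0" using assms by simp_all
  show "1 / (1 - qvar ^ b) ^ 2 *
         (qT b (b * c) l (b * n) (int (b * r)) qvar zvar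
          - (- 1) ^ ((b - 1) * n * r) *
            qT b c l n (int r) (qvar ^ b) (zvar ^ b * qvar ^ (n * (b choose 2))))
       - (- (of_nat (fact ((n - 2) * b div c)) / of_nat (fact (n * b div c))
           * (of_nat ((b ^ 2 - 1) * n ^ 2 * (n - 1)) / 24)
           * zvar ^ b * qT b c l (n - 2) (int r - 1) (qvar ^ b) (zvar ^ b)))
    \<in> cyclotomic_ideal b 1"
    using assms by (intro qT_difference_in_cyclotomic_ideal) auto
next
  \<comment> \<open>The second congruence is the case \<open>c = b\<close> of the first, multiplied
    by \<open>(1 - qvar ^ b) ^ 2\<close>, which raises the modulus to
    \<open>\<Phi>\<^sub>b ^ 3\<close>.\<close>
  define L where "L = qT b (b ^ 2) l (b * n) (int (b * r)) qvar zvar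
        - (- 1) ^ ((b - 1) * n * r) *
          qT b b l n (int r) (qvar ^ b) (zvar ^ b * qvar ^ (n * (b choose 2)))"
  define T where "T = zvar ^ b * qT b b l (n - 2) (int r - 1) (qvar ^ b) (zvar ^ b)"
  have b: "b > 0" using assms by simp
  obtain m where m: "n = Suc (Suc m)" using assms(4) by (metis add_2_eq_Suc le_Suc_ex)
  \<comment> \<open>For \<open>c = b\<close> the factorial quotient is
    \<open>(n - 2)! / n! = 1 / (n * (n - 1))\<close>, which reduces \<open>n ^ 2 * (n - 1)\<close>
    to \<open>n\<close>.\<close>
  have coeff: "of_nat (fact ((n - 2) * b div b)) / of_nat (fact (n * b div b)) *
      (of_nat ((b ^ 2 - 1) * n ^ 2 * (n - 1)) / 24) = (of_nat ((b ^ 2 - 1) * n) / 24 :: ratfun)"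
  proof -
    have "fact (n * b div b) = n * (n - 1) * fact ((n - 2) * b div b)"
      using b by (simp add: m algebra_simps)
    moreover have "(of_nat (n * (n - 1)) :: ratfun) \<noteq> 0" "(of_nat (fact ((n - 2) * b div b)) :: ratfun) \<noteq> 0"
      by (simp_all add: m del: of_nat_mult of_nat_Suc of_nat_fact)
    ultimately show ?thesis
      by (simp add: power2_eq_square)
  qed
  have "1 / (1 - qvar ^ b) ^ 2 * L - - (of_nat ((b ^ 2 - 1) * n) / 24 * T) \<in> cyclotomic_ideal b 1"
    using qT_difference_in_cyclotomic_ideal[OF b b dvd_refl assms(4), of l r]
    unfolding coeff by (simp add: L_def T_def power2_eq_square mult.assoc)
  from cyclotomic_ideal_mult[OF one_minus_qpower_in_cyclotomic_ideal[OF b, of 2] this]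
  have "(1 - qvar ^ b) ^ 2 * (1 / (1 - qvar ^ b) ^ 2 * L - - (of_nat ((b ^ 2 - 1) * n) / 24 * T))
      \<in> cyclotomic_ideal b 3" by simp
  also have "(1 - qvar ^ b) ^ 2 * (1 / (1 - qvar ^ b) ^ 2 * L - - (of_nat ((b ^ 2 - 1) * n) / 24 * T)) =
      L - (- (of_nat ((b ^ 2 - 1) * n) / 24 * zvar ^ b * (1 - qvar ^ b) ^ 2 *
        qT b b l (n - 2) (int r - 1) (qvar ^ b) (zvar ^ b)))"
    using qvar_power_neq_1[OF b] by (simp add: T_def field_simps)
  finally show "qT b (b ^ 2) l (b * n) (int (b * r)) qvar zvar
        - (- 1) ^ ((b - 1) * n * r) *
          qT b b l n (int r) (qvar ^ b) (zvar ^ b * qvar ^ (n * (b choose 2)))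
      - (- (of_nat ((b ^ 2 - 1) * n) / 24 * zvar ^ b * (1 - qvar ^ b) ^ 2 *
        qT b b l (n - 2) (int r - 1) (qvar ^ b) (zvar ^ b))) \<in> cyclotomic_ideal b 3"
    unfolding L_def .
qed

end
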